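(* Let $T$ be an ordered tree bigraph of radius $r$ with $t\ge2$ vertices. Let $n\ge 1$ be an integer, and let $G$ be an ordered bigraph that contains neither $T$ nor the bicomplement of $T$, with $|V_1(G)|,|V_2(G)|\ge n$. Let $K\ge0$ be the real number with $t^{K^r}=n$. Then there is a pure pair $(Z_1,Z_2)$ with $Z_i\subseteq V_i(G)$ and $|Z_i|\ge (16t^2)^{-t}\,n\,t^{-5K^{r-1}}$ for $i=1,2$ (where $K^0=1$).
   Context: All graphs are finite, with no loops or parallel edges. A bigraph is a graph $G$ together with a bipartition $(V_1(G),V_2(G))$ of its vertex set (the two parts are disjoint with union $V(G)$, and every edge joins a vertex of $V_1(G)$ to a vertex of $V_2(G)$). An ordered bigraph is a bigraph with a linear order on $V_1(G)$ and a linear order on $V_2(G)$. The bicomplement of a bigraph is obtained by reversing the adjacency of $v_1,v_2$ for all $v_1$ in the first part and $v_2$ in the second part (keeping the parts, and the orders in the ordered case). An ordered bigraph $G$ contains an ordered bigraph $H$ if there is an induced subgraph $H'$ of $G$ and a graph isomorphism from $H$ to $H'$ mapping $V_i(H)$ into $V_i(G)$ for $i=1,2$ and carrying the order of $V_i(H)$ to the order inherited from $V_i(G)$, for $i=1,2$. An ordered tree bigraph is an ordered bigraph whose underlying graph is a tree. The radius of a tree $T$ is the minimum $r$ such that for some vertex $v$, every vertex of $T$ can be joined to $v$ by a path with at most $r$ edges. A pair $(Z_1,Z_2)$ of disjoint vertex sets is pure if either every vertex of $Z_1$ is adjacent to every vertex of $Z_2$, or there are no edges between $Z_1$ and $Z_2$.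 *)

theory Defs imports Complex_Main begin

record 'a sgraph =
  verts :: "'a set"
  edges :: "'a set set"

record 'a bigraph = "'a sgraph" +
  part1 :: "'a set"
  part2 :: "'a set"

record 'a ordered_bigraph = "'a bigraph" +
  order1 :: "'a rel"
  order2 :: "'a rel"

locale sgraph =
  fixes G :: "('a, 'b) sgraph_scheme"
  assumes finite_verts: "finite (verts G)"
    and edges_wf: "e \<in> edges G \<Longrightarrow> e \<subseteq> verts G \<and> card e = 2"

locale bigraph = sgraph G for G :: "('a, 'b) bigraph_scheme" +
  assumes parts_disjoint: "part1 G \<inter> part2 G = {}"
    and parts_cover: "part1 G \<union> part2 G = verts G"
    and edges_across: "e \<in> edges G \<Longrightarrow> \<exists>u\<in>part1 G. \<exists>v\<in>part2 G. e = {u, v}"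

locale ordered_bigraph = bigraph G for G :: "('a, 'b) ordered_bigraph_scheme" +
  assumes linear_order1: "linear_order_on (part1 G) (order1 G)"
    and linear_order2: "linear_order_on (part2 G) (order2 G)"

definition adjacent :: "('a, 'b) sgraph_scheme \<Rightarrow> 'a \<Rightarrow> 'a \<Rightarrow> bool" where
  "adjacent G u v \<longleftrightarrow> {u, v} \<in> edges G"

text \<open>Paths and cycles are lists of distinct vertices; a path \<open>p\<close> has \<open>length p - 1\<close> edges.\<close>

definition is_path :: "('a, 'b) sgraph_scheme \<Rightarrow> 'a \<Rightarrow> 'a list \<Rightarrow> 'a \<Rightarrow> bool" where
  "is_path G u p v \<longleftrightarrow> p \<noteq> [] \<and> hd p = u \<and> last p = v \<and> distinct p \<and> set p \<subseteq> verts G \<and>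
     (\<forall>i. Suc i < length p \<longrightarrow> adjacent G (p ! i) (p ! Suc i))"

definition is_cycle :: "('a, 'b) sgraph_scheme \<Rightarrow> 'a list \<Rightarrow> bool" where
  "is_cycle G p \<longleftrightarrow> length p \<ge> 3 \<and> is_path G (hd p) p (last p) \<and> adjacent G (last p) (hd p)"

definition is_connected :: "('a, 'b) sgraph_scheme \<Rightarrow> bool" where
  "is_connected G \<longleftrightarrow> verts G \<noteq> {} \<and> (\<forall>u\<in>verts G. \<forall>v\<in>verts G. \<exists>p. is_path G u p v)"

definition is_tree :: "('a, 'b) sgraph_scheme \<Rightarrow> bool" where
  "is_tree G \<longleftrightarrow> sgraph G \<and> is_connected G \<and> (\<nexists>p. is_cycle G p)"

definition ordered_tree_bigraph :: "('a, 'b) ordered_bigraph_scheme \<Rightarrow> bool" where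
  "ordered_tree_bigraph T \<longleftrightarrow> ordered_bigraph T \<and> is_tree T"

text \<open>Only meaningful when \<open>T\<close> is finite and connected.\<close>

definition radius :: "('a, 'b) sgraph_scheme \<Rightarrow> nat" where
  "radius T = (LEAST r. \<exists>v\<in>verts T. \<forall>w\<in>verts T. \<exists>p. is_path T w p v \<and> length p - 1 \<le> r)"

definition bicomplement :: "('a, 'b) bigraph_scheme \<Rightarrow> ('a, 'b) bigraph_scheme" where
  "bicomplement G = G\<lparr>edges := {{u, v} |u v. u \<in> part1 G \<and> v \<in> part2 G \<and> \<not> adjacent G u v}\<rparr>"

definition induced :: "('a, 'b) sgraph_scheme \<Rightarrow> 'a set \<Rightarrow> 'a sgraph" where
  "induced G W = \<lparr>verts = W, edges = {e \<in> edges G. e \<subseteq> W}\<rparr>"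

definition graph_iso :: "('a \<Rightarrow> 'b) \<Rightarrow> ('a, 'c) sgraph_scheme \<Rightarrow> ('b, 'd) sgraph_scheme \<Rightarrow> bool" where
  "graph_iso f H H' \<longleftrightarrow> bij_betw f (verts H) (verts H') \<and>
     (\<forall>u\<in>verts H. \<forall>v\<in>verts H. adjacent H u v \<longleftrightarrow> adjacent H' (f u) (f v))"

definition contains ::
    "('a, 'c) ordered_bigraph_scheme \<Rightarrow> ('b, 'd) ordered_bigraph_scheme \<Rightarrow> bool" where
  "contains G H \<longleftrightarrow> (\<exists>W f. W \<subseteq> verts G \<and> graph_iso f H (induced G W) \<and>
     f ` part1 H \<subseteq> part1 G \<and> f ` part2 H \<subseteq> part2 G \<and>
     (\<forall>u\<in>part1 H. \<forall>v\<in>part1 H. (u, v) \<in> order1 H \<longleftrightarrow> (f u, f v) \<in> order1 G) \<and>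
     (\<forall>u\<in>part2 H. \<forall>v\<in>part2 H. (u, v) \<in> order2 H \<longleftrightarrow> (f u, f v) \<in> order2 G))"

definition pure_pair :: "('a, 'b) sgraph_scheme \<Rightarrow> 'a set \<Rightarrow> 'a set \<Rightarrow> bool" where
  "pure_pair G Z1 Z2 \<longleftrightarrow> Z1 \<subseteq> verts G \<and> Z2 \<subseteq> verts G \<and> Z1 \<inter> Z2 = {} \<and>
     ((\<forall>u\<in>Z1. \<forall>v\<in>Z2. adjacent G u v) \<or> (\<forall>u\<in>Z1. \<forall>v\<in>Z2. \<not> adjacent G u v))"

end

theory Submission imports Defs begin

text \<open>
\<^bold>\<open>Removing the orders.\<close> Cut each side of the host into consecutive intervals, one for each vertex
of \<open>T\<close> on that side. A copy of \<open>T\<close> with the vertex \<open>x\<close> in its own interval \<open>W x\<close> respects both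
orders automatically. So it suffices to find an induced copy of an unordered tree with
prescribed blocks \<open>W x\<close> for its vertices.

\<^bold>\<open>Reduction to a sparse host.\<close> Try to embed the smaller side of \<open>T\<close> greedily, keeping sets of
candidates for the vertices of the other side (\<open>embed_if_no_sparse_pair\<close>). As \<open>T\<close> cannot be found, at some
point a large set of vertices in one block has the wrong adjacency to nearly all candidates in
another block. So there is a large pair of sets between which the graph or its bicomplement
has small degrees (\<open>sparse_or_dense_pair\<close>). This costs the factor \<open>(16t\<^sup>2) powr (-t)\<close>. From now on,
edges are those of whichever of the two is sparse: a copy of \<open>T\<close> for these edges is a
copy of \<open>T\<close> or of its bicomplement in \<open>G\<close>, and two sets without such edges form a pure pair.

\<^bold>\<open>Embedding a tree in a sparse host.\<close> Let \<open>\<Delta>\<close> be the maximum degree. To embed the subtree at \<open>x\<close>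
with root \<open>v\<close>, embed the subtrees at the children of \<open>x\<close> in turn, with roots in the neighbourhood of
\<open>v\<close>, avoiding all neighbours of what was chosen before (\<open>rooted_copy_extend\<close>). If this
fails, then for some child \<open>y\<close> half of the neighbours of \<open>v\<close> in \<open>W y\<close> cannot serve as roots once some
\<open>2t\<^sup>2\<Delta>\<close> vertices are forbidden. If it fails for all \<open>v\<close>, collect such useless sets
for various \<open>v\<close>. When every \<open>v\<close> has at least \<open>\<delta>\<close> neighbours outside the sets already collected,
\<open>s\<close> useless vertices are collected at the price of about \<open>4t\<^sup>2s\<Delta>/\<delta>\<close> forbidden ones. If the ratio of
\<open>\<delta>\<close> and \<open>\<Delta>\<close> is not too small, this contradicts the embedding of the smaller subtree at \<open>y\<close>, by
induction on the height (\<open>rooted_copy_exists\<close>).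

\<^bold>\<open>Enforcing density.\<close> The embedding needs that, at each level of the tree, two sets of a certain
size always contain a vertex of a certain degree into the other set. If this fails, pass to the two
sets, where the maximum degree is much smaller, and start again (\<open>copy_in_sparse\<close>). Sizes and degrees
are tuned so that the number of vertices on each side remains at least \<open>C \<Delta> powr (2/K)\<close> for a
constant \<open>C\<close>. Since \<open>n powr (2/K) = t powr (2 K ^ (r - 1))\<close>, all the repetitions together cost two of the five
\<open>K ^ (r - 1)\<close> in the exponent; the other three are the price of the lowest level, where failure of
density means that there is no edge at all between the two sets, i.e. that they form a pure pair.
\<close>

section \<open>Embedding a tree into prescribed blocks\<close>

text \<open>
Levels count upwards from the leaves towards the root, so that the level of a vertex bounds the
height of the subtree below it; all estimates below are indexed by level. Only parenthood matters
here, so no root is fixed: the structure is a forest.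
\<close>

locale leveled_tree =
  fixes V :: "'a set" and TE :: "'a \<Rightarrow> 'a \<Rightarrow> bool" and lev :: "'a \<Rightarrow> nat"
  assumes finite_V: "finite V"
    and TE_sym: "TE x y \<Longrightarrow> TE y x"
    and TE_lev: "\<lbrakk>x \<in> V; y \<in> V; TE x y\<rbrakk> \<Longrightarrow> lev x = Suc (lev y) \<or> lev y = Suc (lev x)"
    and parent_unique: "\<lbrakk>x \<in> V; x' \<in> V; y \<in> V; TE x y; TE x' y;
      lev x = Suc (lev y); lev x' = Suc (lev y)\<rbrakk> \<Longrightarrow> x = x'"
begin

definition children :: "'a \<Rightarrow> 'a set" where
  "children x = {y \<in> V. TE x y \<and> lev x = Suc (lev y)}"

definition descent :: "('a \<times> 'a) set" where
  "descent = {(x, y). x \<in> V \<and> y \<in> children x}"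

definition desc :: "'a \<Rightarrow> 'a set" where
  "desc x = {y. (x, y) \<in> descent\<^sup>*}"

lemma children_subset: "children x \<subseteq> V"
  by (auto simp: children_def)

lemma finite_children: "finite (children x)"
  using children_subset finite_V finite_subset by blast

lemma self_in_desc [simp]: "x \<in> desc x"
  by (simp add: desc_def)

lemma desc_subset: assumes "x \<in> V" shows "desc x \<subseteq> V"
proof
  fix y assume "y \<in> desc x"
  then have "(x, y) \<in> descent\<^sup>*" by (simp add: desc_def)
  then show "y \<in> V" using assms
    by (induction rule: rtrancl_induct) (auto simp: descent_def children_def)
qed

lemma desc_unfold: assumes "x \<in> V" shows "desc x = insert x (\<Union>y\<in>children x. desc y)"
proof (intro set_eqI iffI)
  fix w assume "w \<in> desc x"
  then have "(x, w) \<in> descent\<^sup>*" by (simp add: desc_def)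
  then show "w \<in> insert x (\<Union>y\<in>children x. desc y)"
    by (cases rule: converse_rtranclE) (auto simp: desc_def descent_def)
next
  fix w assume "w \<in> insert x (\<Union>y\<in>children x. desc y)"
  then show "w \<in> desc x" using assms
    by (auto simp: desc_def descent_def intro: converse_rtrancl_into_rtrancl)
qed

lemma desc_lev: assumes "w \<in> desc x" shows "w = x \<or> lev w < lev x"
proof -
  have "(x, w) \<in> descent\<^sup>*" using assms by (simp add: desc_def)
  then show ?thesis
    by (induction rule: rtrancl_induct) (auto simp: descent_def children_def)
qed

lemma desc_step: "\<lbrakk>w \<in> desc x; w \<in> V; u \<in> children w\<rbrakk> \<Longrightarrow> u \<in> desc x"
  by (auto simp: desc_def descent_def intro: rtrancl_into_rtrancl)

lemma desc_siblings_disjoint: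
  assumes "x \<in> V" "y \<in> children x" "y' \<in> children x" "y \<noteq> y'"
  shows "desc y \<inter> desc y' = {}"
proof (rule ccontr)
  assume "desc y \<inter> desc y' \<noteq> {}"
  then obtain w where "(y, w) \<in> descent\<^sup>*" "(y', w) \<in> descent\<^sup>*"
    by (auto simp: desc_def)
  then have "(w, y) \<in> (descent\<inverse>)\<^sup>*" "(w, y') \<in> (descent\<inverse>)\<^sup>*"
    by (auto simp: rtrancl_converse)
  moreover have "single_valued (descent\<inverse>)"
    using parent_unique by (auto simp: single_valued_def descent_def children_def)
  ultimately have "(y, y') \<in> (descent\<inverse>)\<^sup>* \<or> (y', y) \<in> (descent\<inverse>)\<^sup>*"
    using single_valued_confluent by metis
  then have "y \<in> desc y' \<or> y' \<in> desc y" by (auto simp: desc_def rtrancl_converse)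
  moreover have "lev y = lev y'" using assms by (simp add: children_def)
  ultimately show False using desc_lev assms(4) by fastforce
qed

lemma TE_siblings:
  assumes "x \<in> V" "y \<in> children x" "y' \<in> children x" "y \<noteq> y'" "w \<in> desc y" "w' \<in> desc y'"
  shows "\<not> TE w w'"
proof
  assume TE: "TE w w'"
  have V: "w \<in> V" "w' \<in> V"
    using assms desc_subset children_subset by blast+
  then have "w' \<in> children w \<or> w \<in> children w'"
    using TE_lev[OF V TE] TE TE_sym by (auto simp: children_def)
  then have "desc y \<inter> desc y' \<noteq> {}"
    using V desc_step assms(5,6) by blast
  then show False using desc_siblings_disjoint assms by blast
qed

lemma TE_root:
  assumes "x \<in> V" "w \<in> desc x" shows "TE x w \<longleftrightarrow> w \<in> children x"
proof
  assume TE: "TE x w"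
  have "w \<in> V" using assms desc_subset by blast
  moreover have "w = x \<or> lev w < lev x" using desc_lev assms by blast
  ultimately show "w \<in> children x"
    using TE_lev[OF assms(1) _ TE] TE by (auto simp: children_def)
qed (auto simp: children_def)

lemma TE_irrefl: "x \<in> V \<Longrightarrow> \<not> TE x x"
  using TE_lev by fastforce

lemma root_notin_desc: "\<lbrakk>y \<in> children x\<rbrakk> \<Longrightarrow> x \<notin> desc y"
  using desc_lev[of x y] by (auto simp: children_def)

end

text \<open>
The host of the embedding: the tree vertex \<open>x\<close> must be mapped into the block \<open>W x\<close>. The children
of a vertex lie on one side of the bipartition, whence the absence of edges between their blocks.
\<close>

locale block_graph = leveled_tree V TE lev
  for V :: "'a set" and TE lev +
  fixes W :: "'a \<Rightarrow> 'b set" and E :: "'b \<Rightarrow> 'b \<Rightarrow> bool" and \<Delta> :: real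
  assumes finite_W: "x \<in> V \<Longrightarrow> finite (W x)"
    and E_sym: "E a b \<Longrightarrow> E b a"
    and E_irrefl: "\<not> E a a"
    and no_sibling_edges: "\<lbrakk>x \<in> V; y \<in> children x; y' \<in> children x; a \<in> W y; b \<in> W y'\<rbrakk> \<Longrightarrow> \<not> E a b"
    and degree: "\<lbrakk>x \<in> V; y \<in> V; a \<in> W x\<rbrakk> \<Longrightarrow> real (card {b \<in> W y. E a b}) \<le> \<Delta>"
    and Delta_nonneg: "0 \<le> \<Delta>"
begin

definition copy :: "'a \<Rightarrow> ('a \<Rightarrow> 'b) \<Rightarrow> bool" where
  "copy x f \<longleftrightarrow> (\<forall>w\<in>desc x. f w \<in> W w) \<and>
     (\<forall>w\<in>desc x. \<forall>w'\<in>desc x. E (f w) (f w') \<longleftrightarrow> TE w w')"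

text \<open>
Induced copies of the subtree below \<open>x\<close> that are rooted in \<open>S\<close>; the forbidden sets \<open>R\<close> constrain
the proper descendants only, because the root is controlled by \<open>S\<close>.
\<close>

definition rooted_copy :: "'a \<Rightarrow> 'b set \<Rightarrow> ('a \<Rightarrow> 'b set) \<Rightarrow> bool" where
  "rooted_copy x S R \<longleftrightarrow> (\<exists>f. copy x f \<and> f x \<in> S \<and> (\<forall>w\<in>desc x - {x}. f w \<notin> R w))"

text \<open>
A heavy vertex is adjacent to more than a fraction \<open>1/(2t)\<close> of \<open>S\<close>, where \<open>t\<close> is the number of tree
vertices. If the copies chosen so far avoid heavy vertices, they are together adjacent to at most
half of \<open>S\<close>.
\<close>

definition heavy :: "'b set \<Rightarrow> 'b \<Rightarrow> bool" where
  "heavy S a \<longleftrightarrow> real (card S) < 2 * real (card V) * real (card {s \<in> S. E a s})"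

text \<open>
Double counting: every vertex of \<open>S\<close> sends at most \<open>\<Delta>\<close> edges into \<open>W w\<close>.
\<close>

lemma card_heavy:
  assumes "y \<in> V" "w \<in> V" "S \<subseteq> W y"
  shows "real (card {a \<in> W w. heavy S a}) \<le> 2 * real (card V) * \<Delta>"
proof -
  define H where "H = {a \<in> W w. heavy S a}"
  have fS: "finite S" using assms finite_W finite_subset by blast
  have fH: "finite H" using assms finite_W by (simp add: H_def)
  show ?thesis
  proof (cases "S = {}")
    case True
    then have "H = {}" by (auto simp: H_def heavy_def)
    then have "real (card H) \<le> 2 * real (card V) * \<Delta>" using Delta_nonneg by simp
    then show ?thesis by (simp only: H_def)
  next
    case False
    then have S0: "real (card S) > 0" using fS by (simp add: card_gt_0_iff)
    have "real (card H) * real (card S) = (\<Sum>a\<in>H. real (card S))" by simp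
    also have "\<dots> \<le> (\<Sum>a\<in>H. 2 * real (card V) * real (card {s \<in> S. E a s}))"
      by (intro sum_mono) (auto simp: H_def heavy_def)
    also have "\<dots> = 2 * real (card V) * real (\<Sum>a\<in>H. card {s \<in> S. E a s})"
      by (simp add: sum_distrib_left)
    also have "(\<Sum>a\<in>H. card {s \<in> S. E a s}) = (\<Sum>s\<in>S. card {a \<in> H. E a s})"
      using fS fH by (intro sum_multicount_gen) auto
    also have "2 * real (card V) * real \<dots> \<le> 2 * real (card V) * (\<Sum>s\<in>S. \<Delta>)"
    proof -
      have "real (card {a \<in> H. E a s}) \<le> \<Delta>" if "s \<in> S" for s
      proof -
        have "card {a \<in> H. E a s} \<le> card {b \<in> W w. E s b}"
          using assms finite_W E_sym by (intro card_mono) (auto simp: H_def)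
        also have "real \<dots> \<le> \<Delta>" using degree assms that by blast
        finally show ?thesis by simp
      qed
      then have "(\<Sum>s\<in>S. real (card {a \<in> H. E a s})) \<le> (\<Sum>s\<in>S. \<Delta>)" by (rule sum_mono)
      then show ?thesis unfolding of_nat_sum by (intro mult_left_mono) auto
    qed
    also have "\<dots> = 2 * real (card V) * \<Delta> * real (card S)" by simp
    finally show ?thesis using S0 by (simp add: H_def)
  qed
qed

text \<open>
The subtrees below the children of \<open>x\<close> are embedded one after the other. To stay induced, the copy
below the next child \<open>y\<close> has to avoid the neighbours of \<open>v\<close> and of everything chosen before, and its
root must be a vertex of \<open>S y\<close> without earlier neighbours. To keep half of each later \<open>S y\<close>
available, heavy vertices are avoided as well. All this forbids at most \<open>2t\<^sup>2\<Delta>\<close> vertices of each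
block, which is why hypothesis \<open>sub\<close> suffices.
\<close>

lemma rooted_copy_extend:
  assumes x: "x \<in> V" and v: "v \<in> W x"
    and S: "\<And>y. y \<in> children x \<Longrightarrow> S y \<subseteq> {b \<in> W y - R y. E v b}"
    and sub: "\<And>y S' R'. \<lbrakk>y \<in> children x; S' \<subseteq> S y; real (card (S y)) \<le> 2 * real (card S');
        \<And>w. w \<in> V \<Longrightarrow> R' w \<subseteq> W w;
        \<And>w. w \<in> V \<Longrightarrow> real (card (R' w)) \<le> 2 * real (card V) ^ 2 * \<Delta>\<rbrakk>
      \<Longrightarrow> rooted_copy y S' (\<lambda>w. R w \<union> R' w)"
  shows "rooted_copy x {v} R"
proof -
  let ?C = "children x"
  define t where "t = real (card V)"
  have Sfin: "finite (S y)" if "y \<in> ?C" for y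
  proof (rule finite_subset)
    show "S y \<subseteq> W y" using S[OF that] by blast
    show "finite (W y)" using finite_W children_subset that by blast
  qed
  have ch_desc: "desc y \<subseteq> V" if "y \<in> ?C" for y
    using that children_subset desc_subset by blast
  define avoids where "avoids a \<longleftrightarrow> \<not> E v a \<and> (\<forall>y\<in>?C. \<not> heavy (S y) a)" for a
  have "\<exists>f. (\<forall>y\<in>C. f y \<in> S y) \<and> (\<forall>w\<in>(\<Union>y\<in>C. desc y). f w \<in> W w) \<and>
      (\<forall>w\<in>(\<Union>y\<in>C. desc y). \<forall>w'\<in>(\<Union>y\<in>C. desc y). E (f w) (f w') \<longleftrightarrow> TE w w') \<and>
      (\<forall>w\<in>(\<Union>y\<in>C. desc y) - C. f w \<notin> R w \<and> avoids (f w))"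
    if "finite C" "C \<subseteq> ?C" for C
    using that
  proof (induction C rule: finite_induct)
    case empty
    show ?case by simp
  next
    case (insert y C)
    define Dm where "Dm = (\<Union>y\<in>C. desc y)"
    obtain f where f1: "\<forall>y\<in>C. f y \<in> S y" and f2: "\<forall>w\<in>Dm. f w \<in> W w"
      and f3: "\<forall>w\<in>Dm. \<forall>w'\<in>Dm. E (f w) (f w') \<longleftrightarrow> TE w w'"
      and f4: "\<forall>w\<in>Dm - C. f w \<notin> R w \<and> avoids (f w)"
      using insert unfolding Dm_def by auto
    have yC: "y \<in> ?C" and CC: "C \<subseteq> ?C" and yV: "y \<in> V" using insert children_subset by auto
    have DmV: "Dm \<subseteq> V" using CC ch_desc by (auto simp: Dm_def)
    have xDm: "x \<notin> Dm" using CC root_notin_desc by (auto simp: Dm_def)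
    have finDm: "finite Dm" using DmV finite_V finite_subset by blast
    have cDm: "card Dm + 1 \<le> card V"
      using card_mono[OF finite_V, of "insert x Dm"] DmV x xDm finDm by simp
    have t1: "t \<ge> 1" using cDm by (simp add: t_def)
    \<comment> \<open>roots still available, and the vertices that the copy below \<open>y\<close> must not use\<close>
    define S' where "S' = S y - (\<Union>w\<in>Dm. {s \<in> S y. E (f w) s})"
    define R' where "R' w = {b \<in> W w. E v b} \<union> (\<Union>u\<in>Dm. {b \<in> W w. E (f u) b})
        \<union> (\<Union>y'\<in>?C. {a \<in> W w. heavy (S y') a})" for w
    have kill: "2 * t * real (card {s \<in> S y. E (f w) s}) \<le> real (card (S y))" if w: "w \<in> Dm" for w
    proof (cases "w \<in> C")
      case True
      then have "f w \<in> W w" using f2 w by blast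
      then have "{s \<in> S y. E (f w) s} = {}"
        using no_sibling_edges[OF x _ yC] True CC S[OF yC] by blast
      then show ?thesis by (simp only: card.empty)
    next
      case False
      then have "\<not> heavy (S y) (f w)" using f4 w yC by (auto simp: avoids_def)
      then show ?thesis by (simp add: heavy_def t_def)
    qed
    have "real (card (S y)) \<le> 2 * real (card S')"
    proof -
      have "card (\<Union>w\<in>Dm. {s \<in> S y. E (f w) s}) \<le> (\<Sum>w\<in>Dm. card {s \<in> S y. E (f w) s})"
        using finDm by (rule card_UN_le)
      then have "2 * t * real (card (\<Union>w\<in>Dm. {s \<in> S y. E (f w) s}))
          \<le> (\<Sum>w\<in>Dm. 2 * t * real (card {s \<in> S y. E (f w) s}))"
        using t1 by (simp flip: sum_distrib_left of_nat_sum)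
      also have "\<dots> \<le> (\<Sum>w\<in>Dm. real (card (S y)))" by (intro sum_mono kill)
      also have "\<dots> \<le> t * real (card (S y))"
        using cDm by (auto simp: t_def intro!: mult_right_mono)
      finally have "2 * real (card (\<Union>w\<in>Dm. {s \<in> S y. E (f w) s})) \<le> real (card (S y))"
        using t1 by (auto simp: mult.assoc mult.left_commute)
      moreover have "card S' = card (S y) - card (\<Union>w\<in>Dm. {s \<in> S y. E (f w) s})"
        unfolding S'_def using Sfin[OF yC] by (intro card_Diff_subset) (auto intro: finite_subset)
      ultimately show ?thesis by linarith
    qed
    moreover have "S' \<subseteq> S y" by (auto simp: S'_def)
    moreover have "R' w \<subseteq> W w" if "w \<in> V" for w by (auto simp: R'_def)
    moreover have "real (card (R' w)) \<le> 2 * real (card V) ^ 2 * \<Delta>" if w: "w \<in> V" for w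
    proof -
      have a: "real (card {b \<in> W w. E v b}) \<le> \<Delta>" using degree x w v by blast
      have "real (card (\<Union>u\<in>Dm. {b \<in> W w. E (f u) b})) \<le> real (\<Sum>u\<in>Dm. card {b \<in> W w. E (f u) b})"
        using card_UN_le[OF finDm] of_nat_le_iff by blast
      also have "\<dots> \<le> (\<Sum>u\<in>Dm. \<Delta>)" unfolding of_nat_sum
        using f2 DmV degree w by (intro sum_mono) blast
      finally have b: "real (card (\<Union>u\<in>Dm. {b \<in> W w. E (f u) b})) \<le> card Dm * \<Delta>" by simp
      have "real (card (\<Union>y'\<in>?C. {a \<in> W w. heavy (S y') a}))
          \<le> real (\<Sum>y'\<in>?C. card {a \<in> W w. heavy (S y') a})"
        using card_UN_le[OF finite_children] of_nat_le_iff by blast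
      also have "\<dots> \<le> (\<Sum>y'\<in>?C. 2 * t * \<Delta>)" unfolding of_nat_sum t_def
      proof (rule sum_mono)
        fix y' assume y': "y' \<in> ?C"
        show "real (card {a \<in> W w. heavy (S y') a}) \<le> 2 * real (card V) * \<Delta>"
          using card_heavy[of y' w "S y'"] S[OF y'] children_subset w y' by blast
      qed
      also have "\<dots> = card ?C * (2 * t * \<Delta>)" by simp
      also have "\<dots> \<le> (t - 1) * (2 * t * \<Delta>)"
      proof -
        have "x \<notin> ?C" by (auto simp: children_def)
        then have "card ?C + 1 \<le> card V"
          using card_mono[OF finite_V, of "insert x ?C"] children_subset x finite_children by simp
        then show ?thesis using Delta_nonneg t1 by (intro mult_right_mono) (auto simp: t_def)
      qed
      finally have c: "real (card (\<Union>y'\<in>?C. {a \<in> W w. heavy (S y') a})) \<le> (t - 1) * (2 * t * \<Delta>)" .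
      have "card (R' w) \<le> card {b \<in> W w. E v b} + card (\<Union>u\<in>Dm. {b \<in> W w. E (f u) b})
          + card (\<Union>y'\<in>?C. {a \<in> W w. heavy (S y') a})"
        unfolding R'_def by (meson card_Un_le add_right_mono order_trans)
      then have "real (card (R' w)) \<le> \<Delta> + card Dm * \<Delta> + (t - 1) * (2 * t * \<Delta>)"
        using a b c by linarith
      also have "\<dots> \<le> t * \<Delta> + (t - 1) * (2 * t * \<Delta>)"
      proof -
        have "(1 + card Dm) * \<Delta> \<le> t * \<Delta>" using cDm Delta_nonneg
          by (intro mult_right_mono) (auto simp: t_def)
        then show ?thesis by (simp add: algebra_simps)
      qed
      also have "\<dots> \<le> 2 * t\<^sup>2 * \<Delta>"
        using Delta_nonneg t1 by (simp add: algebra_simps power2_eq_square)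
      finally show ?thesis by (simp add: t_def)
    qed
    ultimately have "rooted_copy y S' (\<lambda>w. R w \<union> R' w)" using sub[OF yC] by blast
    then obtain g where g: "copy y g" "g y \<in> S'" and gR: "\<forall>w\<in>desc y - {y}. g w \<notin> R w \<union> R' w"
      by (auto simp: rooted_copy_def)
    have gW: "g w \<in> W w" if "w \<in> desc y" for w using g that by (auto simp: copy_def)
    have disj: "desc y \<inter> Dm = {}"
      using desc_siblings_disjoint[OF x yC] CC insert.hyps(2) unfolding Dm_def by blast
    have cross: "\<not> E (f u) (g w)" if "u \<in> Dm" "w \<in> desc y" for u w
    proof (cases "w = y")
      case True
      then show ?thesis using g(2) that by (auto simp: S'_def)
    next
      case False
      then have "g w \<notin> R' w" using gR that by blast
      then show ?thesis using gW that by (auto simp: R'_def)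
    qed
    have crossT: "\<not> TE u w" if uw: "u \<in> Dm" "w \<in> desc y" for u w
    proof -
      from uw(1) obtain y' where "y' \<in> C" "u \<in> desc y'" unfolding Dm_def by blast
      then show ?thesis using TE_siblings[OF x _ yC _ _ uw(2), of y' u] CC insert.hyps(2) by blast
    qed
    define h where "h w = (if w \<in> desc y then g w else f w)" for w
    have hD: "h w = f w" if "w \<in> Dm" for w using disj that by (auto simp: h_def)
    have hg: "h w = g w" if "w \<in> desc y" for w using that by (simp add: h_def)
    have U: "(\<Union>y\<in>insert y C. desc y) = desc y \<union> Dm" by (simp add: Dm_def)
    have CDm: "C \<subseteq> Dm" by (auto simp: Dm_def)
    show ?case
    proof (intro exI[of _ h] conjI)
      show "\<forall>y\<in>insert y C. h y \<in> S y"
        using f1 g(2) hD hg CDm by (auto simp: S'_def)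
      show "\<forall>w\<in>(\<Union>y\<in>insert y C. desc y). h w \<in> W w"
        unfolding U using f2 gW hD hg by (auto simp del: self_in_desc)
      show "\<forall>w\<in>(\<Union>y\<in>insert y C. desc y). \<forall>w'\<in>(\<Union>y\<in>insert y C. desc y).
          E (h w) (h w') \<longleftrightarrow> TE w w'"
      proof (intro ballI)
        fix w w' assume "w \<in> (\<Union>y\<in>insert y C. desc y)" "w' \<in> (\<Union>y\<in>insert y C. desc y)"
        then consider "w \<in> desc y" "w' \<in> desc y" | "w \<in> desc y" "w' \<in> Dm"
          | "w \<in> Dm" "w' \<in> desc y" | "w \<in> Dm" "w' \<in> Dm" unfolding U by blast
        then show "E (h w) (h w') \<longleftrightarrow> TE w w'"
        proof cases
          case 1 then show ?thesis using g(1) hg by (simp add: copy_def)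
        next
          case 2 then show ?thesis using cross crossT E_sym TE_sym hD hg by metis
        next
          case 3 then show ?thesis using cross crossT hD hg by metis
        next
          case 4 then show ?thesis using f3 hD by simp
        qed
      qed
      show "\<forall>w\<in>(\<Union>y\<in>insert y C. desc y) - insert y C. h w \<notin> R w \<and> avoids (h w)"
      proof
        fix w assume w: "w \<in> (\<Union>y\<in>insert y C. desc y) - insert y C"
        show "h w \<notin> R w \<and> avoids (h w)"
        proof (cases "w \<in> desc y")
          case True
          then have "g w \<notin> R w \<union> R' w" "g w \<in> W w" using gR w gW by auto
          then show ?thesis using hg[OF True] by (auto simp: R'_def avoids_def)
        next
          case False
          then have "w \<in> Dm - C" using w unfolding U by blast
          then show ?thesis using f4 hD by auto
        qed
      qed
    qed
  qed
  from this[OF finite_children order.refl] obtain f where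
    f1: "\<forall>y\<in>?C. f y \<in> S y" and f2: "\<forall>w\<in>(\<Union>y\<in>?C. desc y). f w \<in> W w"
    and f3: "\<forall>w\<in>(\<Union>y\<in>?C. desc y). \<forall>w'\<in>(\<Union>y\<in>?C. desc y). E (f w) (f w') \<longleftrightarrow> TE w w'"
    and f4: "\<forall>w\<in>(\<Union>y\<in>?C. desc y) - ?C. f w \<notin> R w \<and> avoids (f w)"
    by (elim exE conjE) (rule that; assumption)
  define D' where "D' = (\<Union>y\<in>?C. desc y)"
  have dx: "desc x = insert x D'" using desc_unfold[OF x] by (simp add: D'_def)
  have xD: "x \<notin> D'" using root_notin_desc by (auto simp: D'_def)
  define h where "h = f(x := v)"
  have hf: "h w = f w" if "w \<in> D'" for w using xD that by (auto simp: h_def)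
  have hx: "h x = v" by (simp add: h_def)
  have Ev: "E v (f w) \<longleftrightarrow> TE x w" if w: "w \<in> D'" for w
  proof -
    have "TE x w \<longleftrightarrow> w \<in> ?C" using TE_root[OF x] dx w by blast
    moreover have "E v (f w)" if "w \<in> ?C" using f1 S that by blast
    moreover have "\<not> E v (f w)" if "w \<notin> ?C" using f4 w that by (auto simp: D'_def avoids_def)
    ultimately show ?thesis by blast
  qed
  have "copy x h" unfolding copy_def dx
  proof (intro conjI ballI)
    fix w assume "w \<in> insert x D'" then show "h w \<in> W w"
      using hf hx v f2[folded D'_def] by (cases "w = x") auto
  next
    fix w w' assume "w \<in> insert x D'" "w' \<in> insert x D'"
    then show "E (h w) (h w') \<longleftrightarrow> TE w w'"
      using hf hx Ev E_sym TE_sym E_irrefl TE_irrefl[OF x] f3[folded D'_def] by (metis insertE)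
  qed
  moreover have "h w \<notin> R w" if "w \<in> desc x - {x}" for w
  proof -
    have w: "w \<in> D'" using that dx by blast
    show ?thesis
    proof (cases "w \<in> ?C")
      case True then show ?thesis using f1 S hf[OF w] by auto
    next
      case False then show ?thesis using f4 hf[OF w] w by (auto simp: D'_def)
    qed
  qed
  ultimately show ?thesis using hx by (auto simp: rooted_copy_def)
qed


text \<open>
Induction on the level. Suppose that \<open>Z\<close> contains no root of a copy. For each child \<open>y\<close> take a
largest set \<open>U y\<close> of fewer than \<open>k\<close> vertices of \<open>W y\<close> none of which is the root of a copy once
few further vertices are forbidden, where the allowance is proportional to the size of \<open>U y\<close>.
By density, some \<open>v\<close> in \<open>Z\<close> has at least \<open>\<delta>\<close> neighbours in every child block outside \<open>U y\<close>.
As \<open>v\<close> is not a root, \<open>rooted_copy_extend\<close> yields a child \<open>y\<close> for which half of these neighbours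
are useless after forbidding \<open>2t\<^sup>2\<Delta>\<close> vertices. Adding them to \<open>U y\<close> respects the allowance, so by
maximality the enlarged set reaches size \<open>k\<close>, and the induction hypothesis for \<open>y\<close> is contradicted.

At each level the forbidden sets grow by at most \<open>m/(2t)\<close>, hence they never exceed half of a block.
\<close>

lemma rooted_copy_exists:
  fixes z k \<delta> :: "nat \<Rightarrow> real" and m :: real and r :: nat
  assumes r: "r \<le> card V"
    and k_pos: "\<And>h. h \<le> r \<Longrightarrow> 0 < k h"
    and k_z: "\<And>h. \<lbrakk>1 \<le> h; h \<le> r\<rbrakk> \<Longrightarrow> real (card V) * z h \<le> k h"
    and z_pos: "\<And>h. \<lbrakk>1 \<le> h; h \<le> r\<rbrakk> \<Longrightarrow> 0 < z h"
    and room: "\<And>h. h < r \<Longrightarrow> z (Suc h) \<le> m / 2 - k h"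
    and \<delta>_pos: "\<And>h. \<lbrakk>1 \<le> h; h \<le> r\<rbrakk> \<Longrightarrow> 0 < \<delta> h"
    and budget: "\<And>h. h < r \<Longrightarrow>
      2 * real (card V) ^ 2 * \<Delta> * (2 * k h / \<delta> (Suc h) + 1) \<le> m / (2 * real (card V))"
    and m_pos: "0 < m"
    and W_large: "\<And>x. x \<in> V \<Longrightarrow> m \<le> real (card (W x))"
    and dense: "\<And>x y X Y. \<lbrakk>x \<in> V; y \<in> children x; 1 \<le> lev x; lev x \<le> r; X \<subseteq> W x; Y \<subseteq> W y;
        z (lev x) \<le> real (card X); z (lev x) \<le> real (card Y)\<rbrakk> \<Longrightarrow>
        \<exists>v\<in>X. \<delta> (lev x) \<le> real (card {b \<in> Y. E v b})"
    and x: "x \<in> V" and lev: "lev x = h" "h \<le> r"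
    and Z: "Z \<subseteq> W x" "k h \<le> real (card Z)"
    and R: "\<And>w. w \<in> V \<Longrightarrow> R w \<subseteq> W w"
      "\<And>w. w \<in> V \<Longrightarrow> real (card (R w)) \<le> real (r - h) * (m / (2 * real (card V)))"
  shows "rooted_copy x Z R"
  using x lev Z R
proof (induction h arbitrary: x Z R)
  case 0
  then have "children x = {}" by (auto simp: children_def)
  then have "desc x = {x}" using desc_unfold[of x] 0 by simp
  moreover obtain v where "v \<in> Z" using 0 k_pos[of 0] by fastforce
  ultimately have "copy x (\<lambda>_. v)" "v \<in> Z"
    using 0 E_irrefl TE_irrefl by (auto simp: copy_def)
  then show ?case using \<open>desc x = {x}\<close> by (auto simp: rooted_copy_def)
next
  case (Suc h)
  define t where "t = real (card V)"
  define \<tau> where "\<tau> = 2 * real (card V) ^ 2 * \<Delta>"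
  define d where "d = \<delta> (Suc h)"
  have tpos: "0 < t" using Suc.prems(1) finite_V by (auto simp: t_def card_gt_0_iff)
  have d: "0 < d" using \<delta>_pos Suc.prems by (simp add: d_def)
  have \<tau>: "0 \<le> \<tau>" using Delta_nonneg by (simp add: \<tau>_def)
  have budget': "\<tau> * (2 * k h / d + 1) \<le> m / (2 * t)"
    using budget[of h] Suc.prems by (simp add: \<tau>_def d_def t_def)
  show ?case
  proof (rule ccontr)
    assume none: "\<not> rooted_copy x Z R"
    define bad where "bad y U R' \<longleftrightarrow> U \<subseteq> W y - R y \<and> real (card U) < k h \<and>
        (\<forall>w\<in>V. R' w \<subseteq> W w \<and> real (card (R' w)) \<le> \<tau> * (2 * card U / d)) \<and>
        \<not> rooted_copy y U (\<lambda>w. R w \<union> R' w)" for y U R'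
    have "\<exists>U R'. bad y U R' \<and> (\<forall>U2 R2. bad y U2 R2 \<longrightarrow> card U2 \<le> card U)"
      if y: "y \<in> children x" for y
    proof -
      have "bad y {} (\<lambda>_. {})"
        using k_pos[of h] Suc.prems \<tau> d by (auto simp: bad_def rooted_copy_def)
      then have ex: "\<exists>R'. bad y {} R'" by blast
      have "finite (W y)" using y children_subset finite_W by blast
      then have "\<forall>U. (\<exists>R'. bad y U R') \<longrightarrow> card U < Suc (card (W y))"
        by (auto simp: bad_def less_Suc_eq_le intro!: card_mono)
      from ex_has_greatest_nat[OF ex this] show ?thesis by metis
    qed
    then obtain U R' where UR: "\<And>y. y \<in> children x \<Longrightarrow> bad y (U y) (R' y)"
      and max: "\<And>y U2 R2. \<lbrakk>y \<in> children x; bad y U2 R2\<rbrakk> \<Longrightarrow> card U2 \<le> card (U y)"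
      by metis
    have finU: "finite (U y)" if "y \<in> children x" for y
    proof (rule finite_subset)
      show "U y \<subseteq> W y" using UR[OF that] by (auto simp: bad_def)
      show "finite (W y)" using finite_W children_subset that by blast
    qed
    define S where "S v y = {b \<in> W y - R y - U y. E v b}" for v y
    have Rcard: "real (card (R w)) \<le> m / 2" if "w \<in> V" for w
    proof -
      have "real (r - Suc h) \<le> t" using r by (simp add: t_def)
      then have "real (r - Suc h) * (m / (2 * t)) \<le> t * (m / (2 * t))"
        using m_pos tpos by (intro mult_right_mono) auto
      also have "\<dots> = m / 2" using tpos by simp
      finally show ?thesis using Suc.prems(7)[OF that] unfolding t_def by linarith
    qed
    have zh: "0 < z (Suc h)" using z_pos Suc.prems by simp
    have poor: "real (card {v \<in> Z. real (card (S v y)) < d}) < z (Suc h)" if y: "y \<in> children x" for y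
    proof (rule ccontr)
      assume "\<not> ?thesis"
      then have c: "z (lev x) \<le> real (card {v \<in> Z. real (card (S v y)) < d})"
        using Suc.prems by simp
      have yV: "y \<in> V" using y children_subset by blast
      have "card (W y) \<le> card (W y - R y - U y) + card (R y) + card (U y)"
      proof -
        have "(W y - R y - U y) \<union> R y \<union> U y = W y"
          using UR[OF y] Suc.prems(6)[OF yV] by (auto simp: bad_def)
        then show ?thesis
          using card_Un_le[of "W y - R y - U y \<union> R y" "U y"] card_Un_le[of "W y - R y - U y" "R y"]
          by simp
      qed
      moreover have "real (card (U y)) < k h" using UR[OF y] by (simp add: bad_def)
      ultimately have "m - m / 2 - k h \<le> real (card (W y - R y - U y))"
        using W_large[OF yV] Rcard[OF yV] by linarith
      then have c2: "z (lev x) \<le> real (card (W y - R y - U y))"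
        using room[of h] Suc.prems by simp
      obtain v where "v \<in> Z" "real (card (S v y)) < d"
          "\<delta> (lev x) \<le> real (card {b \<in> W y - R y - U y. E v b})"
        using dense[OF Suc.prems(1) y _ _ _ _ c c2] Suc.prems by auto
      then show False using Suc.prems by (simp add: S_def d_def)
    qed
    have "\<exists>v\<in>Z. \<forall>y\<in>children x. d \<le> real (card (S v y))"
    proof (rule ccontr)
      assume "\<not> ?thesis"
      then have "Z \<subseteq> (\<Union>y\<in>children x. {v \<in> Z. real (card (S v y)) < d})"
        by (auto simp: not_le)
      moreover have "finite Z" using Suc.prems finite_W finite_subset by blast
      ultimately have "card Z \<le> card (\<Union>y\<in>children x. {v \<in> Z. real (card (S v y)) < d})"
        using finite_children by (intro card_mono) auto
      also have "\<dots> \<le> (\<Sum>y\<in>children x. card {v \<in> Z. real (card (S v y)) < d})"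
        by (rule card_UN_le[OF finite_children])
      finally have "real (card Z) \<le> real (\<Sum>y\<in>children x. card {v \<in> Z. real (card (S v y)) < d})"
        by (simp only: of_nat_le_iff)
      also have "\<dots> \<le> (\<Sum>y\<in>children x. z (Suc h))"
        unfolding of_nat_sum using poor by (intro sum_mono) (auto intro: less_imp_le)
      also have "\<dots> = card (children x) * z (Suc h)" by simp
      also have "\<dots> < card V * z (Suc h)"
      proof -
        have "x \<notin> children x" by (simp add: children_def)
        then have "children x \<subset> V" using children_subset Suc.prems(1) by blast
        then show ?thesis using zh psubset_card_mono[OF finite_V] by simp
      qed
      also have "\<dots> \<le> k (Suc h)" using k_z Suc.prems by simp
      finally show False using Suc.prems by simp
    qed
    then obtain v where v: "v \<in> Z" and vS: "\<And>y. y \<in> children x \<Longrightarrow> d \<le> real (card (S v y))"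
      by blast
    have "\<exists>y S' R2. y \<in> children x \<and> S' \<subseteq> S v y \<and> real (card (S v y)) \<le> 2 * real (card S') \<and>
        (\<forall>w\<in>V. R2 w \<subseteq> W w \<and> real (card (R2 w)) \<le> \<tau>) \<and>
        \<not> rooted_copy y S' (\<lambda>w. R w \<union> R2 w)"
    proof (rule ccontr)
      assume no_such: "\<not> ?thesis"
      have "rooted_copy x {v} R"
      proof (rule rooted_copy_extend[where S = "S v"])
        show "x \<in> V" by (rule Suc.prems(1))
        show "v \<in> W x" using v Suc.prems(4) by blast
        show "S v y \<subseteq> {b \<in> W y - R y. E v b}" for y by (auto simp: S_def)
        show "rooted_copy y S' (\<lambda>w. R w \<union> R2 w)"
          if "y \<in> children x" "S' \<subseteq> S v y" "real (card (S v y)) \<le> 2 * real (card S')"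
            "\<And>w. w \<in> V \<Longrightarrow> R2 w \<subseteq> W w"
            "\<And>w. w \<in> V \<Longrightarrow> real (card (R2 w)) \<le> 2 * real (card V) ^ 2 * \<Delta>" for y S' R2
        proof -
          have "\<forall>w\<in>V. R2 w \<subseteq> W w \<and> real (card (R2 w)) \<le> \<tau>" using that by (simp add: \<tau>_def)
          then show ?thesis using no_such that(1-3) by blast
        qed
      qed
      then show False using none v by (auto simp: rooted_copy_def)
    qed
    then obtain y S' R2 where y: "y \<in> children x" and S': "S' \<subseteq> S v y"
      and half: "real (card (S v y)) \<le> 2 * real (card S')"
      and R2: "\<And>w. w \<in> V \<Longrightarrow> R2 w \<subseteq> W w" "\<And>w. w \<in> V \<Longrightarrow> real (card (R2 w)) \<le> \<tau>"
      and no: "\<not> rooted_copy y S' (\<lambda>w. R w \<union> R2 w)"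
      by blast
    have yV: "y \<in> V" and levy: "lev y = h" using y Suc.prems(2) by (auto simp: children_def)
    have finS': "finite S'" using S' finite_W[OF yV] by (auto simp: S_def intro: finite_subset)
    have half': "d \<le> 2 * real (card S')" using half vS[OF y] by linarith
    define U3 where "U3 = U y \<union> S'"
    define R3 where "R3 w = R' y w \<union> R2 w" for w
    have cU3: "card U3 = card (U y) + card S'"
      unfolding U3_def using finU[OF y] finS' S' by (intro card_Un_disjoint) (auto simp: S_def)
    have U3W: "U3 \<subseteq> W y - R y" using UR[OF y] S' by (auto simp: U3_def bad_def S_def)
    have R3W: "R3 w \<subseteq> W w" if "w \<in> V" for w
      using UR[OF y] R2 that by (auto simp: R3_def bad_def)
    have R3c: "real (card (R3 w)) \<le> \<tau> * (2 * card (U y) / d + 1)" if w: "w \<in> V" for w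
    proof -
      have "real (card (R3 w)) \<le> real (card (R' y w)) + real (card (R2 w))"
        unfolding R3_def using card_Un_le[of "R' y w" "R2 w"] by simp
      also have "\<dots> \<le> \<tau> * (2 * card (U y) / d) + \<tau>"
        using UR[OF y] R2(2)[OF w] w by (intro add_mono) (auto simp: bad_def)
      finally show ?thesis by (simp add: algebra_simps)
    qed
    have noU3: "\<not> rooted_copy y U3 (\<lambda>w. R w \<union> R3 w)"
    proof
      assume "rooted_copy y U3 (\<lambda>w. R w \<union> R3 w)"
      then obtain f where f: "copy y f" "f y \<in> U3" "\<forall>w\<in>desc y - {y}. f w \<notin> R w \<union> R3 w"
        by (auto simp: rooted_copy_def)
      show False
      proof (cases "f y \<in> S'")
        case True
        then show False using f no unfolding rooted_copy_def R3_def by blast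
      next
        case False
        then have "f y \<in> U y" using f(2) by (simp add: U3_def)
        then have "rooted_copy y (U y) (\<lambda>w. R w \<union> R' y w)"
          using f unfolding rooted_copy_def R3_def by blast
        then show False using UR[OF y] by (simp add: bad_def)
      qed
    qed
    show False
    proof (cases "real (card U3) < k h")
      case True
      have "real (card (R3 w)) \<le> \<tau> * (2 * card U3 / d)" if w: "w \<in> V" for w
      proof -
        have "2 * card (U y) / d + 1 \<le> 2 * card U3 / d"
          using half' d by (simp add: cU3 field_simps)
        then show ?thesis using R3c[OF w] \<tau> by (meson mult_left_mono order_trans)
      qed
      then have "bad y U3 R3" using True U3W R3W noU3 by (simp add: bad_def)
      then have "card U3 \<le> card (U y)" using max y by blast
      then show False using half' d cU3 by simp
    next
      case False
      have "rooted_copy y U3 (\<lambda>w. R w \<union> R3 w)"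
      proof (rule Suc.IH[OF yV levy])
        show "h \<le> r" using Suc.prems by simp
        show "U3 \<subseteq> W y" using U3W by blast
        show "k h \<le> real (card U3)" using False by simp
        show "R w \<union> R3 w \<subseteq> W w" if "w \<in> V" for w
          using R3W[OF that] Suc.prems(6)[OF that] by blast
        show "real (card (R w \<union> R3 w)) \<le> real (r - h) * (m / (2 * real (card V)))"
          if w: "w \<in> V" for w
        proof -
          have "real (card (U y)) \<le> k h" using UR[OF y] by (simp add: bad_def)
          then have "\<tau> * (2 * card (U y) / d + 1) \<le> \<tau> * (2 * k h / d + 1)"
            using \<tau> d by (intro mult_left_mono add_mono divide_right_mono) auto
          then have "real (card (R3 w)) \<le> m / (2 * t)" using R3c[OF w] budget' by linarith
          moreover have "real (card (R w \<union> R3 w)) \<le> real (card (R w)) + real (card (R3 w))"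
            using card_Un_le[of "R w" "R3 w"] by simp
          moreover have "real (r - h) * (m / (2 * t)) = real (r - Suc h) * (m / (2 * t)) + m / (2 * t)"
          proof -
            have "real (r - h) = real (r - Suc h) + 1" using Suc.prems(3) by simp
            then show ?thesis by (simp only: distrib_right mult_1)
          qed
          ultimately show ?thesis using Suc.prems(7)[OF w] unfolding t_def by linarith
        qed
      qed
      then show False using noU3 by blast
    qed
  qed
qed

end

section \<open>Sizes and degrees at each level\<close>

text \<open>
After trimming both sets to the same size, the average degree from \<open>Y\<close> to \<open>X\<close> is at most \<open>\<rho>\<close>, and
discarding the vertices of \<open>Y\<close> with more than twice that degree costs at most half of \<open>Y\<close>.
\<close>

lemma balance_degrees:
  fixes E :: "'b \<Rightarrow> 'c \<Rightarrow> bool" and z \<rho> :: real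
  assumes fin: "finite X" "finite Y"
    and X: "z \<le> real (card X)" and Y: "z \<le> real (card Y)"
    and deg: "\<And>a. a \<in> X \<Longrightarrow> real (card {b \<in> Y. E a b}) \<le> \<rho>"
    and z: "0 < z"
  obtains X' Y' where "X' \<subseteq> X" "Y' \<subseteq> Y" "z / 2 \<le> real (card X')" "z / 2 \<le> real (card Y')"
    "\<And>a. a \<in> X' \<Longrightarrow> real (card {b \<in> Y'. E a b}) \<le> 2 * \<rho>"
    "\<And>b. b \<in> Y' \<Longrightarrow> real (card {a \<in> X'. E a b}) \<le> 2 * \<rho>"
proof -
  define M where "M = nat \<lceil>z\<rceil>"
  have M: "z \<le> real M" "0 < M" using z by (auto simp: M_def)
  have "M \<le> card X" "M \<le> card Y" using X Y z by (auto simp: M_def nat_le_iff ceiling_le_iff)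
  then obtain X' Y1 where X': "X' \<subseteq> X" "card X' = M" and Y1: "Y1 \<subseteq> Y" "card Y1 = M"
    by (meson obtain_subset_with_card_n)
  have fX': "finite X'" and fY1: "finite Y1" using X' Y1 fin finite_subset by blast+
  have degX': "real (card {b \<in> U. E a b}) \<le> \<rho>" if "a \<in> X'" "U \<subseteq> Y" for a U
  proof -
    have "card {b \<in> U. E a b} \<le> card {b \<in> Y. E a b}"
      using that fin by (intro card_mono) auto
    then show ?thesis using deg[of a] that X' by fastforce
  qed
  have \<rho>: "0 \<le> \<rho>"
  proof -
    obtain a where "a \<in> X'" using M X' by fastforce
    then show ?thesis using degX'[of a "{}"] by simp
  qed
  define B where "B = {b \<in> Y1. 2 * \<rho> < real (card {a \<in> X'. E a b})}"
  have fB: "finite B" using fY1 by (simp add: B_def)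
  have "2 * real (card B) \<le> real M"
  proof (cases "\<rho> = 0")
    case True
    have "E a b \<Longrightarrow> a \<in> X' \<Longrightarrow> b \<in> Y1 \<Longrightarrow> False" for a b
    proof -
      assume *: "E a b" "a \<in> X'" "b \<in> Y1"
      then have "card {b \<in> Y1. E a b} = 0" using degX'[of a Y1] True Y1 by simp
      then show False using * fY1 by auto
    qed
    then have "{a \<in> X'. E a b} = {}" if "b \<in> Y1" for b using that by blast
    then have "B = {}" unfolding B_def using True by (auto simp del: Collect_empty_eq)
    then show ?thesis by simp
  next
    case False
    have "real (card B) * (2 * \<rho>) = (\<Sum>b\<in>B. 2 * \<rho>)" by simp
    also have "\<dots> \<le> (\<Sum>b\<in>B. real (card {a \<in> X'. E a b}))"
      by (intro sum_mono) (auto simp: B_def)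
    also have "\<dots> = real (\<Sum>b\<in>B. card {a \<in> X'. E a b})" by simp
    also have "(\<Sum>b\<in>B. card {a \<in> X'. E a b}) = (\<Sum>a\<in>X'. card {b \<in> B. E a b})"
      using fX' fB by (intro sum_multicount_gen[symmetric]) auto
    also have "real \<dots> \<le> (\<Sum>a\<in>X'. \<rho>)" unfolding of_nat_sum
      using Y1 by (intro sum_mono degX') (auto simp: B_def)
    also have "\<dots> = real M * \<rho>" using X' by simp
    finally have "(2 * real (card B)) * \<rho> \<le> real M * \<rho>" by simp
    then show ?thesis using False \<rho> by simp
  qed
  moreover have "card (Y1 - B) = M - card B"
    using fB Y1 by (subst card_Diff_subset) (auto simp: B_def)
  ultimately have "real M / 2 \<le> real (card (Y1 - B))" by linarith
  then have "z / 2 \<le> real (card (Y1 - B))" "z / 2 \<le> real (card X')" using M X' z by auto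
  moreover have "real (card {b \<in> Y1 - B. E a b}) \<le> 2 * \<rho>" if "a \<in> X'" for a
    using degX'[OF that, of "Y1 - B"] Y1 \<rho> by fastforce
  moreover have "real (card {a \<in> X'. E a b}) \<le> 2 * \<rho>" if "b \<in> Y1 - B" for b
    using that by (auto simp: B_def not_less)
  ultimately show ?thesis using that[of X' "Y1 - B"] X' Y1 by blast
qed

text \<open>
The two thresholds of the sparse case, for a host with \<open>N\<close> vertices on each side and maximum degree
\<open>\<Delta>\<close>: at level \<open>i \<ge> 2\<close>, the host counts as dense if any two sets of \<open>small_size\<close> vertices
in the blocks of a parent and a child contain a vertex with \<open>scale * \<Delta> / 2\<close> neighbours on the other
side. At level 1, density just means that there is an edge.

The exponents have to satisfy two conflicting demands. Collecting useless vertices at level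
\<open>i + 1\<close> multiplies the number of forbidden vertices by the inverse of the scale at \<open>i + 1\<close>,
so \<open>small_size\<close> at \<open>i\<close> must be that much smaller. On the other hand, if density fails at
level \<open>i\<close>, then \<open>N\<close> shrinks to about \<open>small_size\<close> while the degree shrinks by the scale at \<open>i\<close>,
and this trade must preserve a lower bound of the form \<open>N \<ge> C \<Delta> powr (2/K)\<close>. So the exponent has
to grow by a factor of at least \<open>K/2\<close> per level downwards. The factor \<open>K\<close> chosen here leaves room for
the powers of \<open>t\<close>. The summand 4 pays for such powers at the bottom level.
\<close>

definition scale :: "nat \<Rightarrow> nat \<Rightarrow> real \<Rightarrow> nat \<Rightarrow> real" where
  "scale t r K i = real t powr (4 - 3 * K ^ (r + 1 - i))"

definition small_size :: "nat \<Rightarrow> nat \<Rightarrow> real \<Rightarrow> real \<Rightarrow> nat \<Rightarrow> real" where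
  "small_size t r K N i =
    (if i = r then N / (2 * real t ^ 2) else N * scale t r K (Suc i) / (32 * real t ^ 5))"

context
  fixes t r :: nat and K :: real
  assumes t2: "2 \<le> t" and K5: "5 \<le> K"
begin

lemma scale_pos: "0 < scale t r K i"
  using t2 by (simp add: scale_def)

lemma scale_le_half:
  assumes "i \<le> r" shows "scale t r K i \<le> 1 / 2"
proof -
  have "K ^ 1 \<le> K ^ (r + 1 - i)" using K5 assms by (intro power_increasing) auto
  then have "scale t r K i \<le> real t powr (-1)"
    using t2 K5 unfolding scale_def by (intro powr_mono) auto
  also have "\<dots> \<le> 1 / 2" using t2 by (simp add: powr_minus divide_simps)
  finally show ?thesis .
qed

lemma small_size_pos: "0 < N \<Longrightarrow> 0 < small_size t r K N i"
  using scale_pos t2 by (auto simp: small_size_def)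

lemma small_size_le:
  assumes "0 \<le> N" "i \<le> r"
  shows "small_size t r K N i \<le> N / (2 * real t ^ 2)"
proof (cases "i = r")
  case False
  then have "scale t r K (Suc i) \<le> 1" using scale_le_half[of "Suc i"] assms by simp
  then have "N * scale t r K (Suc i) \<le> N * 1" using assms by (intro mult_left_mono) auto
  then have "small_size t r K N i \<le> N / (32 * real t ^ 5)"
    using False t2 by (simp add: small_size_def divide_right_mono)
  also have "\<dots> \<le> N / (2 * real t ^ 2)"
  proof (rule divide_left_mono)
    have "real t ^ 2 \<le> real t ^ 5" using t2 by (intro power_increasing) auto
    moreover have "0 \<le> real t ^ 5" by simp
    ultimately show "2 * real t ^ 2 \<le> 32 * real t ^ 5" by linarith
  qed (use assms t2 in auto)
  finally show ?thesis .
qed (simp add: small_size_def)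

lemma small_size_room:
  assumes h: "h < r" and N: "64 * real t ^ 4 \<le> N"
  shows "small_size t r K N (Suc h) \<le>
    N / real t / 2 - (if h = 0 then 1 else real t * small_size t r K N h)"
proof -
  define T where "T = real t"
  have T: "2 \<le> T" using t2 by (simp add: T_def)
  have N0: "0 \<le> N" using N by (smt (verit) zero_le_power of_nat_0_le_iff)
  have a: "small_size t r K N (Suc h) \<le> N / (2 * T ^ 2)"
    using small_size_le[of N "Suc h"] h N0 by (simp add: T_def)
  have b: "(if h = 0 then 1 else real t * small_size t r K N h) \<le> N / (8 * T)"
  proof (cases "h = 0")
    case True
    have "8 * T \<le> 64 * T ^ 4"
      using power_increasing[of 1 4 T] T by simp
    then show ?thesis using True N T by (simp add: T_def field_simps)
  next
    case False
    have "scale t r K (Suc h) \<le> 1" using scale_le_half[of "Suc h"] h by simp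
    then have "N * scale t r K (Suc h) \<le> N * 1" using N0 by (intro mult_left_mono) auto
    then have "T * small_size t r K N h \<le> T * (N / (32 * T ^ 5))"
      using h T by (simp add: small_size_def divide_right_mono T_def)
    also have "\<dots> = N / (32 * T ^ 4)" using T by (simp add: power_numeral_reduce)
    also have "\<dots> \<le> N / (8 * T)"
    proof (rule divide_left_mono)
      show "8 * T \<le> 32 * T ^ 4" using power_increasing[of 1 4 T] T by simp
    qed (use T N0 in auto)
    finally show ?thesis using False by (simp add: T_def)
  qed
  have "N / (2 * T ^ 2) \<le> N / (4 * T)"
  proof (rule divide_left_mono)
    show "4 * T \<le> 2 * T ^ 2" using T by (simp add: power2_eq_square)
  qed (use T N0 in auto)
  moreover have "N / (4 * T) + N / (8 * T) \<le> N / T / 2" using T N0 by (simp add: field_simps)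
  ultimately show ?thesis using a b unfolding T_def by linarith
qed

text \<open>
The forbidden vertices collected at one level amount to at most \<open>m/(2t)\<close>, where \<open>m = N/t\<close> is the
block size.
\<close>

lemma small_size_budget:
  assumes h: "h < r" and D: "0 < \<Delta>" "64 * real t ^ 4 * \<Delta> \<le> N"
  shows "2 * real t ^ 2 * \<Delta> * (2 * (if h = 0 then 1 else real t * small_size t r K N h) /
      (if Suc h = 1 then 1 else scale t r K (Suc h) * \<Delta> / 2) + 1) \<le> N / real t / (2 * real t)"
proof -
  define T where "T = real t"
  have T: "2 \<le> T" using t2 by (simp add: T_def)
  have D': "64 * T ^ 4 * \<Delta> \<le> N" using D by (simp add: T_def)
  have D2: "64 * T\<^sup>2 * \<Delta> \<le> N / T\<^sup>2" using D' T by (simp add: field_simps power_numeral_reduce)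
  have e: "N / T / (2 * T) = N / T\<^sup>2 / 2" by (simp add: power2_eq_square)
  have TD: "0 < T\<^sup>2 * \<Delta>" using T D by simp
  show ?thesis
  proof (cases "h = 0")
    case True
    then show ?thesis unfolding T_def[symmetric] e using D2 TD by simp
  next
    case False
    define \<sigma> where "\<sigma> = scale t r K (Suc h)"
    have s: "0 < \<sigma>" using scale_pos by (simp add: \<sigma>_def)
    have "2 * T\<^sup>2 * \<Delta> * (2 * (T * small_size t r K N h) / (\<sigma> * \<Delta> / 2) + 1)
        = N / T\<^sup>2 / 4 + 2 * (T\<^sup>2 * \<Delta>)"
      using h T s D by (simp add: small_size_def \<sigma>_def[symmetric] T_def[symmetric] field_simps power_numeral_reduce)
    also have "\<dots> \<le> N / T / (2 * T)" unfolding e using D2 TD by simp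
    finally show ?thesis using False by (simp add: T_def \<sigma>_def)
  qed
qed

text \<open>
The bottom level is the worst case, and there the scale is \<open>t powr (4 - 3 K ^ (r - 1))\<close>;
this is where the bound on \<open>N\<close> pays three of the five \<open>K ^ (r - 1)\<close> in the theorem.
\<close>

lemma small_size_ge:
  assumes i: "1 \<le> i" "i \<le> r" and p: "0 \<le> p"
    and N: "64 * real t ^ 2 * p * real t powr (3 * K ^ (r - 1)) \<le> N"
  shows "p \<le> small_size t r K N i"
proof -
  define T where "T = real t"
  have T: "2 \<le> T" using t2 by (simp add: T_def)
  define P where "P = T powr (3 * K ^ (r - 1))"
  have P: "1 \<le> P" unfolding P_def using T K5 by (intro ge_one_powr_ge_zero) auto
  have N': "64 * T\<^sup>2 * p * P \<le> N" using N by (simp add: T_def P_def)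
  show ?thesis
  proof (cases "i = r")
    case True
    have "p * 1 \<le> p * (32 * P)" using P p by (intro mult_left_mono) auto
    then have "p * (2 * T\<^sup>2) \<le> p * (32 * P) * (2 * T\<^sup>2)" by (intro mult_right_mono) auto
    then have "p * (2 * T\<^sup>2) \<le> N" using N' by (simp add: algebra_simps)
    then show ?thesis using True T by (simp add: small_size_def T_def field_simps)
  next
    case False
    have "K ^ (r - i) \<le> K ^ (r - 1)" using K5 i by (intro power_increasing) auto
    then have "T powr (4 - 3 * K ^ (r - 1)) \<le> scale t r K (Suc i)"
      using T unfolding scale_def T_def by (intro powr_mono) auto
    moreover have "T powr (4 - 3 * K ^ (r - 1)) = T ^ 4 / P"
      using T by (simp add: P_def powr_diff powr_numeral)
    ultimately have s: "T ^ 4 / P \<le> scale t r K (Suc i)" by simp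
    have "T ^ 5 \<le> T ^ 6" "0 \<le> T ^ 6" using T by (auto intro: power_increasing)
    then have "32 * T ^ 5 \<le> 64 * T ^ 6" by linarith
    then have "p * (32 * T ^ 5) \<le> p * (64 * T ^ 6)" using p by (rule mult_left_mono)
    also have "\<dots> = 64 * T\<^sup>2 * p * P * (T ^ 4 / P)" using P by (simp add: power_numeral_reduce)
    also have "\<dots> \<le> N * scale t r K (Suc i)"
    proof (rule mult_mono[OF N' s])
      have "0 \<le> 64 * T\<^sup>2 * p * P" using p P by simp
      then show "0 \<le> N" using N' by linarith
    qed (use P in auto)
    finally show ?thesis using False T by (simp add: small_size_def T_def field_simps)
  qed
qed

text \<open>
Passing to a pair of sets that violates density at level \<open>i\<close> multiplies the degree by the scale and
replaces \<open>N\<close> by half of \<open>small_size\<close>. The two estimates say that this keeps the invariant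
\<open>N \<ge> C \<Delta> powr (2/K)\<close> and keeps the host sparse.
\<close>

lemma scale_powr:
  assumes i: "2 \<le> i" "i \<le> r" and N: "0 \<le> N"
  shows "N * scale t r K i powr (2 / K) \<le> small_size t r K N i / 2"
    and "N * scale t r K i \<le> small_size t r K N i / 2"
proof -
  define T where "T = real t"
  have T: "2 \<le> T" using t2 by (simp add: T_def)
  have "(4 - 3 * K ^ (r + 1 - i)) * (2 / K) = 8 / K - 6 * K ^ (r - i)"
    using K5 i by (simp add: Suc_diff_le field_simps)
  then have sp: "scale t r K i powr (2 / K) = T powr (8 / K - 6 * K ^ (r - i))"
    using t2 by (simp add: scale_def powr_powr T_def)
  have K8: "8 / K \<le> 2" using K5 by (simp add: field_simps)
  show A: "N * scale t r K i powr (2 / K) \<le> small_size t r K N i / 2"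
  proof (cases "i = r")
    case True
    have "T powr (8 / K - 6 * K ^ (r - i)) \<le> T powr (-4)"
      using True K8 T by (intro powr_mono) auto
    also have "T powr (-4) = 1 / T ^ 4" using T by (simp add: powr_minus powr_numeral divide_simps)
    also have "\<dots> \<le> 1 / (4 * T\<^sup>2)"
    proof (rule divide_left_mono)
      have "2\<^sup>2 \<le> T\<^sup>2" using T by (intro power_mono) auto
      then have "4 * T\<^sup>2 \<le> T\<^sup>2 * T\<^sup>2" by (intro mult_right_mono) auto
      then show "4 * T\<^sup>2 \<le> T ^ 4" by (simp add: power_numeral_reduce)
    qed (use T in auto)
    finally have "N * scale t r K i powr (2 / K) \<le> N * (1 / (4 * T\<^sup>2))"
      unfolding sp using N by (rule mult_left_mono)
    then show ?thesis using True by (simp add: small_size_def T_def)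
  next
    case False
    have "K ^ 1 \<le> K ^ (r - i)" using K5 i False by (intro power_increasing) auto
    then have K': "5 \<le> K ^ (r - i)" using K5 by simp
    have "64 * T ^ 5 = 2 ^ 6 * T powr 5" using T by (simp add: powr_numeral)
    also have "2 ^ 6 * T powr 5 \<le> T ^ 6 * T powr 5" using T by (intro mult_right_mono power_mono) auto
    also have "\<dots> = T powr 11" using T by (simp add: powr_add[symmetric] powr_numeral[symmetric] del: powr_numeral)
    finally have "64 * T ^ 5 * T powr (8 / K - 6 * K ^ (r - i)) \<le> T powr 11 * T powr (8 / K - 6 * K ^ (r - i))"
      by (rule mult_right_mono) auto
    also have "\<dots> = T powr (11 + 8 / K - 6 * K ^ (r - i))" by (simp add: powr_add[symmetric] algebra_simps)
    also have "\<dots> \<le> T powr (4 - 3 * K ^ (r - i))" using T K' K8 by (intro powr_mono) auto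
    finally have "scale t r K i powr (2 / K) \<le> scale t r K (Suc i) / (64 * T ^ 5)"
      unfolding sp using T by (simp add: scale_def T_def field_simps)
    then have "N * scale t r K i powr (2 / K) \<le> N * (scale t r K (Suc i) / (64 * T ^ 5))"
      using N by (rule mult_left_mono)
    then show ?thesis using False by (simp add: small_size_def T_def)
  qed
  have "scale t r K i powr 1 \<le> scale t r K i powr (2 / K)"
    using scale_pos[of i] scale_le_half[of i] i K5 by (intro powr_mono') auto
  then have "scale t r K i \<le> scale t r K i powr (2 / K)" using scale_pos[of i] by simp
  then show "N * scale t r K i \<le> small_size t r K N i / 2"
    using A N by (meson mult_left_mono order_trans)
qed

end

section \<open>Trees in sparse hosts\<close>

context leveled_tree
begin

text \<open>
Induction on the maximum degree. Cut the two sides into blocks. If the blocks are dense at all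
levels, there is a copy. Otherwise two sets of \<open>small_size\<close> violate density at some level
\<open>i\<close>. They are too large to be joined by no edge, so \<open>i \<ge> 2\<close> and the new degree bound is still at
least 1; after balancing, the induction hypothesis applies to them.

The predicate \<open>adm\<close> abstracts from the orders: it is only used to carry the ordering property of the
blocks to the conclusion.
\<close>

lemma copy_in_sparse:
  fixes E :: "'b \<Rightarrow> 'b \<Rightarrow> bool" and p K \<Delta> N :: real and P :: "'a \<Rightarrow> bool"
    and adm :: "('a \<Rightarrow> 'b set) \<Rightarrow> bool"
  assumes t: "2 \<le> card V" and r: "1 \<le> r" "r \<le> card V" and K: "5 \<le> K" and p: "0 \<le> p"
    and lev_le: "\<And>x. x \<in> V \<Longrightarrow> lev x \<le> r"
    and root: "c \<in> V" "desc c = V"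
    and TE_sides: "\<And>x y. \<lbrakk>x \<in> V; y \<in> V; TE x y\<rbrakk> \<Longrightarrow> P x \<noteq> P y"
    and E_sym: "\<And>a b. E a b \<Longrightarrow> E b a"
    and fin: "finite V1" "finite V2" and V12: "V1 \<inter> V2 = {}"
    and E_sides: "\<And>a b. E a b \<Longrightarrow> a \<in> V1 \<and> b \<in> V2 \<or> a \<in> V2 \<and> b \<in> V1"
    and not_pure: "\<And>A B. \<lbrakk>A \<subseteq> V1; B \<subseteq> V2; p \<le> real (card A); p \<le> real (card B)\<rbrakk>
        \<Longrightarrow> \<exists>a\<in>A. \<exists>b\<in>B. E a b"
    and blocks: "\<And>A B M. \<lbrakk>A \<subseteq> V1; B \<subseteq> V2; M \<le> real (card A); M \<le> real (card B);
        real (card V) ^ 2 \<le> M\<rbrakk> \<Longrightarrow>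
        \<exists>W. adm W \<and> (\<forall>x\<in>V. W x \<subseteq> (if P x then A else B) \<and> M / real (card V) \<le> real (card (W x)))"
    and AB: "A \<subseteq> V1" "B \<subseteq> V2" "N \<le> real (card A)" "N \<le> real (card B)"
    and degA: "\<And>a. a \<in> A \<Longrightarrow> real (card {b \<in> B. E a b}) \<le> \<Delta>"
    and degB: "\<And>b. b \<in> B \<Longrightarrow> real (card {a \<in> A. E b a}) \<le> \<Delta>"
    and \<Delta>: "1 \<le> \<Delta>" "64 * real (card V) ^ 4 * \<Delta> \<le> N"
    and N: "64 * real (card V) ^ 2 * p * real (card V) powr (3 * K ^ (r - 1)) * \<Delta> powr (2 / K) \<le> N"
  shows "\<exists>W f. adm W \<and> (\<forall>x\<in>V. f x \<in> W x \<and> W x \<subseteq> (if P x then V1 else V2)) \<and>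
    (\<forall>x\<in>V. \<forall>y\<in>V. E (f x) (f y) \<longleftrightarrow> TE x y)"
  using AB degA degB \<Delta> N
proof (induction "nat \<lfloor>\<Delta>\<rfloor>" arbitrary: A B N \<Delta> rule: less_induct)
  case less
  define t where "t = card V"
  have t2: "2 \<le> t" using t by (simp add: t_def)
  define T where "T = real t"
  have T2: "2 \<le> T" using t2 by (simp add: T_def)
  define C where "C = 64 * T ^ 2 * p * T powr (3 * K ^ (r - 1))"
  have C0: "0 \<le> C" using p by (simp add: C_def)
  have N1: "C * \<Delta> powr (2 / K) \<le> N" using less.prems(9) by (simp add: C_def T_def t_def)
  have CN: "C \<le> N"
  proof -
    have "C * 1 \<le> C * \<Delta> powr (2 / K)"
      using C0 K less.prems(7) by (intro mult_left_mono ge_one_powr_ge_zero) auto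
    then show ?thesis using N1 by simp
  qed
  have DN: "64 * T ^ 4 * \<Delta> \<le> N" using less.prems(8) by (simp add: T_def t_def)
  have NT4: "64 * T ^ 4 \<le> N"
  proof -
    have "64 * T ^ 4 * 1 \<le> 64 * T ^ 4 * \<Delta>"
      using less.prems(7) T2 by (intro mult_left_mono) auto
    then show ?thesis using DN by linarith
  qed
  have "T\<^sup>2 \<le> T ^ 4" using T2 by (intro power_increasing) auto
  moreover have "0 \<le> T ^ 4" using T2 by simp
  ultimately have "T\<^sup>2 \<le> N" using NT4 by linarith
  then have NT: "real (card V) ^ 2 \<le> N" by (simp add: T_def t_def)
  have "0 < T\<^sup>2" using T2 by simp
  then have N0: "0 < N" using \<open>T\<^sup>2 \<le> N\<close> by linarith
  from blocks[OF less.prems(1-4) NT] obtain W where W: "adm W"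
    and WAB: "\<And>x. x \<in> V \<Longrightarrow> W x \<subseteq> (if P x then A else B)"
    and Wc: "\<And>x. x \<in> V \<Longrightarrow> N / T \<le> real (card (W x))"
    unfolding T_def t_def by blast
  have fAB: "finite A" "finite B" using less.prems(1,2) fin finite_subset by blast+
  have sameside: "\<not> E a b" if "x \<in> V" "y \<in> V" "a \<in> W x" "b \<in> W y" "P x = P y" for x y a b
  proof
    assume "E a b"
    then have "a \<in> V1 \<and> b \<in> V2 \<or> a \<in> V2 \<and> b \<in> V1" by (rule E_sides)
    moreover have "a \<in> (if P x then A else B)" "b \<in> (if P x then A else B)"
      using subsetD[OF WAB[OF that(1)] that(3)] subsetD[OF WAB[OF that(2)] that(4)] that(5) by auto
    ultimately show False using less.prems(1,2) V12 by (auto split: if_splits)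
  qed
  interpret block_graph V TE lev W E \<Delta>
  proof
    fix x assume x: "x \<in> V"
    show "finite (W x)" using WAB[OF x] fAB by (auto split: if_splits intro: finite_subset)
  next
    fix a b show "E a b \<Longrightarrow> E b a" by (rule E_sym)
  next
    fix a show "\<not> E a a" using E_sides[of a a] V12 by blast
  next
    fix x y y' a b
    assume "x \<in> V" "y \<in> children x" "y' \<in> children x" "a \<in> W y" "b \<in> W y'"
    then show "\<not> E a b" using sameside[of y y' a b] TE_sides by (auto simp: children_def)
  next
    fix x y a assume xy: "x \<in> V" "y \<in> V" "a \<in> W x"
    show "real (card {b \<in> W y. E a b}) \<le> \<Delta>"
    proof (cases "P x = P y")
      case True
      then have "{b \<in> W y. E a b} = {}" using sameside xy by blast
      then have "card {b \<in> W y. E a b} = 0" by (simp only: card.empty)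
      then show ?thesis using less.prems(7) by simp
    next
      case False
      show ?thesis
      proof (cases "P x")
        case True
        then have "a \<in> A" "W y \<subseteq> B"
          using False WAB[OF xy(1)] WAB[OF xy(2)] xy(3) by auto
        then have "card {b \<in> W y. E a b} \<le> card {b \<in> B. E a b}"
          using fAB by (intro card_mono) auto
        then show ?thesis using less.prems(5)[OF \<open>a \<in> A\<close>] by linarith
      next
        assume "\<not> P x"
        then have "a \<in> B" "W y \<subseteq> A"
          using False WAB[OF xy(1)] WAB[OF xy(2)] xy(3) by auto
        then have "card {b \<in> W y. E a b} \<le> card {b \<in> A. E a b}"
          using fAB by (intro card_mono) auto
        then show ?thesis using less.prems(6)[OF \<open>a \<in> B\<close>] by linarith
      qed
    qed
  next
    show "0 \<le> \<Delta>" using less.prems(7) by simp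
  qed
  define \<delta> where "\<delta> h = (if h = 1 then 1 else scale t r K h * \<Delta> / 2)" for h
  define z where "z = small_size t r K N"
  define k where "k h = (if h = 0 then 1 else real t * z h)" for h
  have zpos: "0 < z h" for h using small_size_pos[OF t2 K N0] by (simp add: z_def)
  show ?case
  proof (cases "\<forall>x\<in>V. \<forall>y\<in>children x. \<forall>X Y. 1 \<le> lev x \<and> lev x \<le> r \<and> X \<subseteq> W x \<and> Y \<subseteq> W y \<and>
        z (lev x) \<le> real (card X) \<and> z (lev x) \<le> real (card Y) \<longrightarrow>
        (\<exists>v\<in>X. \<delta> (lev x) \<le> real (card {b \<in> Y. E v b}))")
    case True
    have "rooted_copy c (W c) (\<lambda>_. {})"
    proof (rule rooted_copy_exists[where z = z and k = k and \<delta> = \<delta> and m = "N / T" and r = r and h = "lev c"])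
      show "r \<le> card V" by (rule r)
      show "0 < k h" for h using zpos t2 by (simp add: k_def)
      show "real (card V) * z h \<le> k h" if "1 \<le> h" "h \<le> r" for h
        using that by (simp add: k_def t_def)
      show "0 < z h" for h by (rule zpos)
      show "z (Suc h) \<le> N / T / 2 - k h" if "h < r" for h
        using small_size_room[OF t2 K that NT4[unfolded T_def]] unfolding z_def k_def T_def .
      show "0 < \<delta> h" for h using scale_pos[OF t2 K] less.prems(7) by (simp add: \<delta>_def)
      show "2 * real (card V) ^ 2 * \<Delta> * (2 * k h / \<delta> (Suc h) + 1) \<le> N / T / (2 * real (card V))"
        if "h < r" for h
      proof -
        have "0 < \<Delta>" using less.prems(7) by simp
        from small_size_budget[OF t2 K that this DN[unfolded T_def]] show ?thesis
          unfolding z_def k_def T_def \<delta>_def t_def .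
      qed
      show "0 < N / T" using N0 T2 by simp
      show "N / T \<le> real (card (W x))" if "x \<in> V" for x by (rule Wc[OF that])
      show "\<exists>v\<in>X. \<delta> (lev x) \<le> real (card {b \<in> Y. E v b})"
        if "x \<in> V" "y \<in> children x" "1 \<le> lev x" "lev x \<le> r" "X \<subseteq> W x" "Y \<subseteq> W y"
          "z (lev x) \<le> real (card X)" "z (lev x) \<le> real (card Y)" for x y X Y
        using True that by blast
      show "c \<in> V" by (rule root)
      show "lev c = lev c" ..
      show "lev c \<le> r" using lev_le root by blast
      show "W c \<subseteq> W c" ..
      show "k (lev c) \<le> real (card (W c))"
      proof -
        have "real t * z (lev c) \<le> real t * (N / (2 * real t ^ 2))"
          using small_size_le[OF t2 K, of N "lev c" r] N0 lev_le root
          by (intro mult_left_mono) (auto simp: z_def)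
        also have "\<dots> = N / T / 2" using t2 by (simp add: T_def power2_eq_square)
        also have "\<dots> \<le> N / T"
        proof -
          have "0 < N / T" using N0 T2 by simp
          moreover have "u / 2 \<le> u" if "0 < u" for u :: real using that by simp
          ultimately show ?thesis by blast
        qed
        finally have a: "real t * z (lev c) \<le> N / T" .
        have "1 \<le> T" using T2 by simp
        also have "T = T\<^sup>2 / T" using T2 by (simp add: power2_eq_square)
        also have "\<dots> \<le> N / T" using \<open>T\<^sup>2 \<le> N\<close> T2 by (intro divide_right_mono) auto
        finally have "1 \<le> N / T" .
        then show ?thesis using a Wc[OF root(1)] by (simp add: k_def)
      qed
    qed (use N0 T2 in auto)
    then obtain f where "copy c f" by (auto simp: rooted_copy_def)
    then have f: "\<forall>x\<in>V. f x \<in> W x" "\<forall>x\<in>V. \<forall>y\<in>V. E (f x) (f y) \<longleftrightarrow> TE x y"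
      using root by (auto simp: copy_def)
    have "W x \<subseteq> (if P x then V1 else V2)" if "x \<in> V" for x
      using WAB[OF that] less.prems(1,2) by (cases "P x") (simp; blast)+
    then show ?thesis using W f by blast
  next
    case False
    then obtain x y X Y where xy: "x \<in> V" "y \<in> children x" and l: "1 \<le> lev x" "lev x \<le> r"
      and XY: "X \<subseteq> W x" "Y \<subseteq> W y" "z (lev x) \<le> real (card X)" "z (lev x) \<le> real (card Y)"
      and few: "\<And>v. v \<in> X \<Longrightarrow> real (card {b \<in> Y. E v b}) < \<delta> (lev x)"
      by (auto simp: not_le)
    define i where "i = lev x"
    define s where "s = scale t r K i"
    have yV: "y \<in> V" using xy children_subset by blast
    have Pxy: "P x \<noteq> P y" using TE_sides xy yV by (auto simp: children_def)
    have fXY: "finite X" "finite Y" using XY finite_W xy yV finite_subset by blast+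
    have pz: "p \<le> z i"
      using small_size_ge[OF t2 K, of i r p N] l p CN by (simp add: z_def i_def C_def T_def)
    have not_anti: "\<exists>a\<in>X. \<exists>b\<in>Y. E a b"
    proof (cases "P x")
      case True
      then have "X \<subseteq> V1" "Y \<subseteq> V2" using WAB[OF xy(1)] WAB[OF yV] XY Pxy less.prems(1,2) by auto
      then show ?thesis using not_pure pz XY by (simp add: i_def)
    next
      case False
      then have "Y \<subseteq> V1" "X \<subseteq> V2" using WAB[OF xy(1)] WAB[OF yV] XY Pxy less.prems(1,2) by auto
      then have "\<exists>a\<in>Y. \<exists>b\<in>X. E a b" using not_pure pz XY by (simp add: i_def)
      then show ?thesis using E_sym by blast
    qed
    have \<delta>1: "1 < \<delta> i"
    proof -
      obtain a b where ab: "a \<in> X" "b \<in> Y" "E a b" using not_anti by blast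
      then have "{b \<in> Y. E a b} \<noteq> {}" by blast
      then have "1 \<le> card {b \<in> Y. E a b}" using fXY by (simp add: Suc_le_eq card_gt_0_iff)
      then show ?thesis using few[OF ab(1)] by (simp add: i_def)
    qed
    then have i2: "2 \<le> i" using l by (auto simp: \<delta>_def i_def split: if_splits)
    have \<delta>s: "\<delta> i = s * \<Delta> / 2" using i2 by (simp add: \<delta>_def s_def)
    have ir: "i \<le> r" using l by (simp add: i_def)
    have s0: "0 < s" using scale_pos[OF t2 K] by (simp add: s_def)
    have s12: "s \<le> 1 / 2" using scale_le_half[OF t2 K ir] by (simp add: s_def)
    obtain X' Y' where X': "X' \<subseteq> X" "z i / 2 \<le> real (card X')"
        "\<And>a. a \<in> X' \<Longrightarrow> real (card {b \<in> Y'. E a b}) \<le> s * \<Delta>"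
      and Y': "Y' \<subseteq> Y" "z i / 2 \<le> real (card Y')"
        "\<And>b. b \<in> Y' \<Longrightarrow> real (card {a \<in> X'. E a b}) \<le> s * \<Delta>"
    proof (rule balance_degrees[OF fXY, of "z i" E "s * \<Delta> / 2"])
      show "z i \<le> real (card X)" "z i \<le> real (card Y)" using XY by (auto simp: i_def)
      show "real (card {b \<in> Y. E a b}) \<le> s * \<Delta> / 2" if "a \<in> X" for a
        using few[OF that] \<delta>s by (simp add: i_def)
    qed (use zpos in auto)
    have Y'3: "\<And>b. b \<in> Y' \<Longrightarrow> real (card {a \<in> X'. E b a}) \<le> s * \<Delta>"
    proof -
      fix b assume b: "b \<in> Y'"
      have "{a \<in> X'. E b a} = {a \<in> X'. E a b}" using E_sym by blast
      then show "real (card {a \<in> X'. E b a}) \<le> s * \<Delta>" using Y'(3)[OF b] by simp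
    qed
    have X'3: "\<And>a. a \<in> X' \<Longrightarrow> real (card {b \<in> Y'. E a b}) \<le> s * \<Delta>" by (rule X'(3))
    have sD: "1 \<le> s * \<Delta>" using \<delta>1 \<delta>s by simp
    have smaller: "nat \<lfloor>s * \<Delta>\<rfloor> < nat \<lfloor>\<Delta>\<rfloor>"
    proof -
      have "s * \<Delta> \<le> \<Delta> / 2" using mult_right_mono[OF s12, of \<Delta>] less.prems(7) by simp
      then have "s * \<Delta> + 1 \<le> \<Delta>" using sD by linarith
      then show ?thesis using sD by linarith
    qed
    have N3: "64 * real (card V) ^ 4 * (s * \<Delta>) \<le> z i / 2"
    proof -
      have "64 * T ^ 4 * (s * \<Delta>) = (64 * T ^ 4 * \<Delta>) * s" by simp
      also have "\<dots> \<le> N * s" using DN s0 by (intro mult_right_mono) auto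
      also have "\<dots> \<le> z i / 2"
        using scale_powr(2)[OF t2 K i2 ir, of N] N0 by (simp add: s_def z_def)
      finally show ?thesis by (simp add: T_def t_def)
    qed
    have N4: "64 * real (card V) ^ 2 * p * real (card V) powr (3 * K ^ (r - 1)) *
        (s * \<Delta>) powr (2 / K) \<le> z i / 2"
    proof -
      have "C * (s * \<Delta>) powr (2 / K) = (C * \<Delta> powr (2 / K)) * s powr (2 / K)"
        using s0 less.prems(7) by (simp add: powr_mult)
      also have "\<dots> \<le> N * s powr (2 / K)" using N1 by (intro mult_right_mono) auto
      also have "\<dots> \<le> z i / 2"
        using scale_powr(1)[OF t2 K i2 ir, of N] N0 by (simp add: s_def z_def)
      finally show ?thesis by (simp add: C_def T_def t_def)
    qed
    show ?thesis
    proof (cases "P x")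
      case True
      then have "X' \<subseteq> V1" "Y' \<subseteq> V2"
        using WAB[OF xy(1)] WAB[OF yV] XY X'(1) Y'(1) Pxy less.prems(1,2) by auto
      then show ?thesis
        using less.hyps[OF smaller _ _ X'(2) Y'(2) X'3 Y'3 sD N3 N4] by blast
    next
      case False
      then have "Y' \<subseteq> V1" "X' \<subseteq> V2"
        using WAB[OF xy(1)] WAB[OF yV] XY X'(1) Y'(1) Pxy less.prems(1,2) by auto
      then show ?thesis
        using less.hyps[OF smaller _ _ Y'(2) X'(2) Y'3 X'3 sD N3 N4] by blast
    qed
  qed
qed

end

section \<open>Finding a sparse or dense pair\<close>

text \<open>
Choose the images of \<open>I\<close> one by one, keeping for each \<open>j\<close> in \<open>J\<close> the set of candidates with the right
adjacencies so far. If every choice in \<open>A i\<close> shrinks some candidate set by more than the factor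
\<open>\<epsilon>\<close>, then by pigeonhole many choices do so for the same \<open>j\<close>, against \<open>sparse\<close>. The failure happens
before the last of the \<open>card I\<close> choices is completed, hence the exponent \<open>card I - 1\<close>.
\<close>

lemma embed_if_no_sparse_pair:
  fixes R :: "'b \<Rightarrow> 'c \<Rightarrow> bool" and Q :: "'i \<Rightarrow> 'j \<Rightarrow> bool" and \<epsilon> :: real
  assumes I: "finite I" and J: "finite J"
    and eps: "0 < \<epsilon>" "\<epsilon> \<le> 1"
    and finA: "\<And>i. i \<in> I \<Longrightarrow> finite (A i)"
    and c: "0 < c" "\<And>j. j \<in> J \<Longrightarrow> c \<le> real (card (B j))"
    and sparse: "\<And>i j X Y. \<lbrakk>i \<in> I; j \<in> J; X \<subseteq> A i; Y \<subseteq> B j; real (card (A i)) \<le> real (card J) * card X;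
        \<epsilon> ^ (card I - 1) * c \<le> real (card Y)\<rbrakk> \<Longrightarrow>
        \<exists>a\<in>X. \<epsilon> * real (card Y) \<le> real (card {b \<in> Y. R a b \<longleftrightarrow> Q i j})"
    and neJ: "J \<noteq> {}"
  obtains f g where "\<And>i. i \<in> I \<Longrightarrow> f i \<in> A i" "\<And>j. j \<in> J \<Longrightarrow> g j \<in> B j"
    "\<And>i j. \<lbrakk>i \<in> I; j \<in> J\<rbrakk> \<Longrightarrow> R (f i) (g j) \<longleftrightarrow> Q i j"
proof -
  have "\<exists>f C. (\<forall>i\<in>I'. f i \<in> A i) \<and> (\<forall>j\<in>J. C j \<subseteq> B j \<and> \<epsilon> ^ card I' * c \<le> real (card (C j)) \<and>
      (\<forall>i\<in>I'. \<forall>b\<in>C j. R (f i) b \<longleftrightarrow> Q i j))"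
    if "finite I'" "I' \<subseteq> I" for I'
    using that
  proof (induction I' rule: finite_induct)
    case empty
    show ?case using c by (intro exI[of _ undefined] exI[of _ B]) auto
  next
    case (insert i I')
    have "I' \<subseteq> I" using insert.prems by blast
    from insert.IH[OF this] obtain f C where f: "\<forall>i\<in>I'. f i \<in> A i"
      and CC: "\<forall>j\<in>J. C j \<subseteq> B j \<and> \<epsilon> ^ card I' * c \<le> real (card (C j)) \<and>
        (\<forall>i\<in>I'. \<forall>b\<in>C j. R (f i) b \<longleftrightarrow> Q i j)"
      by blast
    have C: "\<And>j. j \<in> J \<Longrightarrow> C j \<subseteq> B j" "\<And>j. j \<in> J \<Longrightarrow> \<epsilon> ^ card I' * c \<le> real (card (C j))"
        "\<And>j. j \<in> J \<Longrightarrow> \<forall>i\<in>I'. \<forall>b\<in>C j. R (f i) b \<longleftrightarrow> Q i j"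
      using CC by blast+
    have iI: "i \<in> I" using insert by blast
    have "card I' \<le> card I - 1"
      using insert card_mono[OF I insert.prems] by simp
    then have pw: "\<epsilon> ^ (card I - 1) * c \<le> \<epsilon> ^ card I' * c"
      using eps c by (intro mult_right_mono power_decreasing) auto
    define bad where "bad j = {a \<in> A i. real (card {b \<in> C j. R a b \<longleftrightarrow> Q i j}) < \<epsilon> * real (card (C j))}" for j
    have "\<exists>a\<in>A i. \<forall>j\<in>J. a \<notin> bad j"
    proof (rule ccontr)
      assume "\<not> ?thesis"
      then have cover: "A i \<subseteq> (\<Union>j\<in>J. bad j)" by blast
      have small: "real (card J) * card (bad j) < real (card (A i))" if j: "j \<in> J" for j
      proof (rule ccontr)
        assume "\<not> ?thesis"
        then have "real (card (A i)) \<le> real (card J) * card (bad j)" by simp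
        moreover have "\<epsilon> ^ (card I - 1) * c \<le> real (card (C j))"
          using C(2)[OF j] pw by linarith
        moreover have "bad j \<subseteq> A i" by (auto simp: bad_def)
        ultimately obtain a where "a \<in> bad j"
          "\<epsilon> * real (card (C j)) \<le> real (card {b \<in> C j. R a b \<longleftrightarrow> Q i j})"
          using sparse[OF iI j _ C(1)[OF j], of "bad j"] by blast
        then show False by (simp add: bad_def)
      qed
      have "card (A i) \<le> card (\<Union>j\<in>J. bad j)"
        using cover J finA[OF iI] by (intro card_mono) (auto simp: bad_def)
      also have "\<dots> \<le> (\<Sum>j\<in>J. card (bad j))" by (rule card_UN_le[OF J])
      finally have "real (card J) * card (A i) \<le> real (card J) * real (\<Sum>j\<in>J. card (bad j))"
        by (intro mult_left_mono) (simp_all only: of_nat_le_iff of_nat_0_le_iff)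
      also have "\<dots> = (\<Sum>j\<in>J. real (card J) * card (bad j))"
        by (simp add: sum_distrib_left)
      also have "\<dots> < (\<Sum>j\<in>J. real (card (A i)))"
        using small J neJ by (intro sum_strict_mono) auto
      finally show False by simp
    qed
    then obtain a where a: "a \<in> A i" "\<And>j. j \<in> J \<Longrightarrow> a \<notin> bad j" by blast
    define C' where "C' j = {b \<in> C j. R a b \<longleftrightarrow> Q i j}" for j
    have "\<epsilon> ^ card (insert i I') * c \<le> real (card (C' j))" if j: "j \<in> J" for j
    proof -
      have "\<epsilon> ^ card (insert i I') * c = \<epsilon> * (\<epsilon> ^ card I' * c)" using insert by simp
      also have "\<dots> \<le> \<epsilon> * real (card (C j))" using C(2)[OF j] eps by (intro mult_left_mono) auto
      also have "\<dots> \<le> real (card (C' j))" using a(1) a(2)[OF j] by (simp add: bad_def C'_def not_less)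
      finally show ?thesis .
    qed
    moreover have "\<forall>j\<in>J. C' j \<subseteq> B j" using C(1) by (auto simp: C'_def)
    moreover have "\<forall>j\<in>J. \<forall>i'\<in>insert i I'. \<forall>b\<in>C' j. R ((f(i := a)) i') b \<longleftrightarrow> Q i' j"
      using C(3) insert.hyps(2) by (auto simp: C'_def)
    moreover have "\<forall>i'\<in>insert i I'. (f(i := a)) i' \<in> A i'" using f a insert.hyps(2) by auto
    ultimately show ?case by blast
  qed
  from this[OF I order.refl] obtain f C where f: "\<forall>i\<in>I. f i \<in> A i"
    and C: "\<forall>j\<in>J. C j \<subseteq> B j \<and> \<epsilon> ^ card I * c \<le> real (card (C j)) \<and>
      (\<forall>i\<in>I. \<forall>b\<in>C j. R (f i) b \<longleftrightarrow> Q i j)" by blast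
  have "\<exists>b. b \<in> C j" if "j \<in> J" for j
  proof -
    have "0 < \<epsilon> ^ card I * c" using eps c by simp
    then have "0 < real (card (C j))" using C that by (meson less_le_trans)
    then have "C j \<noteq> {}" by auto
    then show ?thesis by blast
  qed
  then obtain g where "\<And>j. j \<in> J \<Longrightarrow> g j \<in> C j" by metis
  then show ?thesis using that[of f g] f C by blast
qed

text \<open>
Here \<open>\<epsilon> = 1/(16t\<^sup>2)\<^sup>2\<close>. The side \<open>I\<close> that is embedded greedily is the smaller one, so it has at most
\<open>t/2\<close> vertices and \<open>\<epsilon> ^ card I\<close> is at least \<open>(16t\<^sup>2) powr (-t)\<close>. As the exponent is only
\<open>card I - 1\<close>, one factor \<open>1/\<epsilon>\<close> remains, which pays for the blocks, the pigeonhole step and the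
balancing of degrees.
\<close>

lemma sparse_or_dense_pair:
  fixes W :: "'a \<Rightarrow> 'b set" and R :: "'b \<Rightarrow> 'b \<Rightarrow> bool" and n :: nat
  assumes IJ: "finite I" "finite J" "I \<inter> J = {}" "I \<noteq> {}" "J \<noteq> {}" "card I \<le> card J"
    and t: "t = card I + card J"
    and n: "2 * t\<^sup>2 \<le> n"
    and finW: "\<And>x. x \<in> I \<union> J \<Longrightarrow> finite (W x)"
    and W: "\<And>x. x \<in> I \<union> J \<Longrightarrow> real n / real t \<le> real (card (W x))"
    and no: "\<nexists>f. (\<forall>x\<in>I \<union> J. f x \<in> W x) \<and> (\<forall>i\<in>I. \<forall>j\<in>J. R (f i) (f j) \<longleftrightarrow> Q i j)"
  obtains i j X Y N and pos :: bool where "i \<in> I" "j \<in> J" "X \<subseteq> W i" "Y \<subseteq> W j"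
    "N \<le> real (card X)" "N \<le> real (card Y)"
    "\<And>a. a \<in> X \<Longrightarrow> real (card {b \<in> Y. R a b = pos}) \<le> N / (64 * real t ^ 4)"
    "\<And>b. b \<in> Y \<Longrightarrow> real (card {a \<in> X. R a b = pos}) \<le> N / (64 * real t ^ 4)"
    "64 * real t ^ 2 * (real n * (16 * real t ^ 2) powr (- real t)) \<le> N" "N \<le> real n"
proof -
  define T where "T = real t"
  have cI: "1 \<le> card I" "1 \<le> card J" using IJ by (auto simp: Suc_le_eq card_gt_0_iff)
  have T2: "2 \<le> T" using cI t by (simp add: T_def)
  define \<epsilon> where "\<epsilon> = 1 / (256 * T ^ 4)"
  have T4: "1 \<le> T ^ 4" using T2 by (intro one_le_power) auto
  have eps: "0 < \<epsilon>" "\<epsilon> \<le> 1" using T4 by (auto simp: \<epsilon>_def divide_simps)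
  define q where "q = nat \<lfloor>real n / T\<^sup>2\<rfloor>"
  define c where "c = real n / (2 * T\<^sup>2)"
  have n2: "2 * T\<^sup>2 \<le> real n"
    using n unfolding T_def by (metis of_nat_le_iff of_nat_mult of_nat_numeral of_nat_power)
  have q_le: "real q \<le> real n / T\<^sup>2" by (simp add: q_def)
  have cq: "c \<le> real q"
  proof -
    have "2 \<le> real n / T\<^sup>2" using n2 T2 by (simp add: field_simps)
    moreover have "u / 2 \<le> real (nat \<lfloor>u\<rfloor>)" if "2 \<le> u" for u :: real using that by linarith
    ultimately have "real n / T\<^sup>2 / 2 \<le> real q" unfolding q_def by blast
    then show ?thesis by (simp add: c_def mult.commute)
  qed
  have "0 < T\<^sup>2" using T2 by simp
  then have n0: "0 < real n" using n2 by linarith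
  have c0: "0 < c" unfolding c_def using n0 \<open>0 < T\<^sup>2\<close> by (intro divide_pos_pos) auto
  have nTT: "real n / T\<^sup>2 \<le> real n / T"
    using T2 by (intro divide_left_mono) (auto simp: power2_eq_square)
  \<comment> \<open>the sets \<open>B j\<close> are kept smaller than the sets obtained by pigeonhole, so that these can be trimmed to their size\<close>
  have "\<exists>Bj. Bj \<subseteq> W j \<and> card Bj = q" if "j \<in> J" for j
  proof -
    have "q \<le> card (W j)" using q_le nTT W[of j] that unfolding T_def by simp
    then show ?thesis by (metis obtain_subset_with_card_n)
  qed
  then obtain B where B: "\<And>j. j \<in> J \<Longrightarrow> B j \<subseteq> W j" "\<And>j. j \<in> J \<Longrightarrow> card (B j) = q" by metis
  have "\<exists>i\<in>I. \<exists>j\<in>J. \<exists>X Y. X \<subseteq> W i \<and> Y \<subseteq> B j \<and> real (card (W i)) \<le> real (card J) * card X \<and>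
      \<epsilon> ^ (card I - 1) * c \<le> real (card Y) \<and>
      (\<forall>a\<in>X. real (card {b \<in> Y. R a b \<longleftrightarrow> Q i j}) < \<epsilon> * real (card Y))"
  proof (rule ccontr)
    assume neg: "\<not> ?thesis"
    obtain f g where fg: "\<And>i. i \<in> I \<Longrightarrow> f i \<in> W i" "\<And>j. j \<in> J \<Longrightarrow> g j \<in> B j"
      "\<And>i j. \<lbrakk>i \<in> I; j \<in> J\<rbrakk> \<Longrightarrow> R (f i) (g j) \<longleftrightarrow> Q i j"
    proof (rule embed_if_no_sparse_pair[OF IJ(1,2) eps, where A = W and B = B and c = c and R = R and Q = Q])
      show "finite (W i)" if "i \<in> I" for i using finW that by blast
      show "0 < c" by (rule c0)
      show "c \<le> real (card (B j))" if "j \<in> J" for j using cq B(2)[OF that] by simp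
      show "\<exists>a\<in>X. \<epsilon> * real (card Y) \<le> real (card {b \<in> Y. R a b \<longleftrightarrow> Q i j})"
        if "i \<in> I" "j \<in> J" "X \<subseteq> W i" "Y \<subseteq> B j" "real (card (W i)) \<le> real (card J) * card X"
          "\<epsilon> ^ (card I - 1) * c \<le> real (card Y)" for i j X Y
      proof (rule ccontr)
        assume "\<not> ?thesis"
        then have "\<forall>a\<in>X. real (card {b \<in> Y. R a b \<longleftrightarrow> Q i j}) < \<epsilon> * real (card Y)"
          by (simp add: not_le)
        then show False using neg that by blast
      qed
      show "J \<noteq> {}" by (rule IJ)
    qed blast
    define h where "h x = (if x \<in> I then f x else g x)" for x
    have "h i = f i" if "i \<in> I" for i using that by (simp add: h_def)
    moreover have "h j = g j" if "j \<in> J" for j using that IJ(3) by (auto simp: h_def)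
    moreover have "g j \<in> W j" if "j \<in> J" for j using fg(2)[OF that] B(1)[OF that] by blast
    ultimately have "(\<forall>x\<in>I \<union> J. h x \<in> W x) \<and> (\<forall>i\<in>I. \<forall>j\<in>J. R (h i) (h j) \<longleftrightarrow> Q i j)"
      using fg by auto
    then show False using no by blast
  qed
  then obtain i j X Y where ij: "i \<in> I" "j \<in> J" and X: "X \<subseteq> W i" and Y: "Y \<subseteq> B j"
    and cX: "real (card (W i)) \<le> real (card J) * card X" and cY: "\<epsilon> ^ (card I - 1) * c \<le> real (card Y)"
    and few: "\<And>a. a \<in> X \<Longrightarrow> real (card {b \<in> Y. R a b \<longleftrightarrow> Q i j}) < \<epsilon> * real (card Y)"
    by blast
  have YW: "Y \<subseteq> W j" using Y B(1)[OF ij(2)] by blast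
  have fX: "finite X" and fY: "finite Y" using finW X YW ij by (meson UnI1 UnI2 finite_subset)+
  have Yq: "card Y \<le> q"
  proof -
    have "finite (B j)" using B(1)[OF ij(2)] finW ij by (meson UnI2 finite_subset)
    then show ?thesis using card_mono[OF _ Y] B(2)[OF ij(2)] by simp
  qed
  have YX: "real (card Y) \<le> real (card X)"
  proof -
    have "real n / T \<le> real (card (W i))" using W[of i] ij by (simp add: T_def)
    also have "\<dots> \<le> real (card J) * card X" by (rule cX)
    also have "\<dots> \<le> T * card X" using t by (intro mult_right_mono) (auto simp: T_def)
    finally have "real n / T\<^sup>2 \<le> card X" using T2 by (simp add: field_simps power2_eq_square)
    then show ?thesis using Yq q_le by linarith
  qed
  have Y0: "0 < real (card Y)"
  proof -
    have "0 < \<epsilon> ^ (card I - 1) * c" using eps c0 by simp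
    then show ?thesis using cY by linarith
  qed
  define N where "N = real (card Y) / 2"
  obtain X' Y' where X': "X' \<subseteq> X" "real (card Y) / 2 \<le> real (card X')"
      "\<And>a. a \<in> X' \<Longrightarrow> real (card {b \<in> Y'. R a b \<longleftrightarrow> Q i j}) \<le> 2 * (\<epsilon> * real (card Y))"
    and Y': "Y' \<subseteq> Y" "real (card Y) / 2 \<le> real (card Y')"
      "\<And>b. b \<in> Y' \<Longrightarrow> real (card {a \<in> X'. R a b \<longleftrightarrow> Q i j}) \<le> 2 * (\<epsilon> * real (card Y))"
  proof (rule balance_degrees[OF fX fY YX order.refl, of "\<lambda>a b. R a b \<longleftrightarrow> Q i j" "\<epsilon> * real (card Y)"])
    show "real (card {b \<in> Y. R a b \<longleftrightarrow> Q i j}) \<le> \<epsilon> * real (card Y)" if "a \<in> X" for a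
      using few[OF that] by simp
  qed (use Y0 in auto)
  have deg: "2 * (\<epsilon> * real (card Y)) = N / (64 * real t ^ 4)"
    by (simp add: \<epsilon>_def N_def T_def)
  show ?thesis
  proof (rule that[of i j X' Y' N "Q i j"])
    show "N \<le> real n"
    proof -
      have "N \<le> real q" using Yq by (simp add: N_def)
      also have "\<dots> \<le> real n / T\<^sup>2" by (rule q_le)
      also have "\<dots> \<le> real n / 1"
        using T2 by (intro divide_left_mono) (auto intro: one_le_power)
      finally show ?thesis by simp
    qed
    show "64 * real t ^ 2 * (real n * (16 * real t ^ 2) powr (- real t)) \<le> N"
    proof -
      have T16: "1 \<le> 16 * T\<^sup>2" using T2 one_le_power[of T 2] by linarith
      have "(16 * T\<^sup>2) ^ 2 = 256 * T ^ 4" by (simp add: power_mult_distrib flip: power_mult)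
      then have eps_eq: "\<epsilon> = 1 / (16 * T\<^sup>2) ^ 2" by (simp add: \<epsilon>_def)
      have "(16 * T\<^sup>2) powr (- real t) \<le> (16 * T\<^sup>2) powr (- real (2 * card I))"
        using T16 t IJ(6) by (intro powr_mono) auto
      also have "\<dots> = \<epsilon> ^ card I"
      proof -
        have "0 < 16 * T\<^sup>2" using T16 by linarith
        from powr_realpow[OF this] show ?thesis
          by (simp only: eps_eq powr_minus_divide power_one_over power_mult)
      qed
      also have "\<dots> = \<epsilon> * \<epsilon> ^ (card I - 1)" using cI by (cases "card I") auto
      finally have "64 * T\<^sup>2 * (real n * (16 * T\<^sup>2) powr (- real t))
          \<le> 64 * T\<^sup>2 * (real n * (\<epsilon> * \<epsilon> ^ (card I - 1)))"
        by (intro mult_left_mono) auto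
      also have "\<dots> = \<epsilon> ^ (card I - 1) * (64 * T\<^sup>2 * real n / (256 * T ^ 4))"
        by (simp add: \<epsilon>_def)
      also have "64 * T\<^sup>2 * real n / (256 * T ^ 4) = c / 2"
        using T2 by (simp add: c_def field_simps power_numeral_reduce)
      also have "\<epsilon> ^ (card I - 1) * (c / 2) \<le> N" using cY by (simp add: N_def)
      finally show ?thesis by (simp add: T_def)
    qed
  qed (use ij X X' YW Y' deg in \<open>auto simp: N_def\<close>)
qed

section \<open>Levels of a tree\<close>

definition edge_rel :: "('a, 'b) sgraph_scheme \<Rightarrow> 'a rel" where
  "edge_rel T = {(x, y). x \<in> verts T \<and> y \<in> verts T \<and> adjacent T x y}"

lemma adjacent_commute: "adjacent T x y \<longleftrightarrow> adjacent T y x"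
  by (simp add: adjacent_def insert_commute)

lemma is_path_relpow:
  assumes "is_path T u p v" shows "(u, v) \<in> edge_rel T ^^ (length p - 1)"
  using assms
proof (induction p arbitrary: u)
  case Nil
  then show ?case by (simp add: is_path_def)
next
  case (Cons a p)
  show ?case
  proof (cases p)
    case Nil
    then show ?thesis using Cons.prems by (fastforce simp: is_path_def)
  next
    case (Cons b q)
    have tail: "is_path T b p v"
      unfolding is_path_def
    proof (intro conjI allI impI)
      fix i assume "Suc i < length p"
      then show "adjacent T (p ! i) (p ! Suc i)"
        using Cons.prems unfolding is_path_def by (metis Suc_less_eq length_Cons nth_Cons_Suc)
    qed (use Cons.prems Cons in \<open>auto simp: is_path_def\<close>)
    have "adjacent T a b" using Cons.prems Cons by (auto simp: is_path_def)
    then have "(u, b) \<in> edge_rel T" using Cons.prems Cons by (auto simp: is_path_def edge_rel_def)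
    then have "(u, v) \<in> edge_rel T ^^ Suc (length p - 1)"
      using Cons.IH[OF tail] relpow_Suc_I2 by metis
    then show ?thesis using Cons by simp
  qed
qed

text \<open>
Follow the two descending walks from \<open>y\<close> and \<open>z\<close> towards \<open>c\<close> in parallel. Up to the first time they
meet they are disjoint, as the distance to \<open>c\<close> determines the position on each walk, so together with
\<open>x\<close> they form a cycle.
\<close>

lemma tree_no_two_descents:
  fixes d :: "'a \<Rightarrow> nat" and par :: "'a \<Rightarrow> 'a"
  assumes noc: "\<nexists>p. is_cycle T p"
    and par: "\<And>u. \<lbrakk>u \<in> verts T; 0 < d u\<rbrakk> \<Longrightarrow> par u \<in> verts T \<and> adjacent T u (par u) \<and> Suc (d (par u)) = d u"
    and d0: "\<And>u. \<lbrakk>u \<in> verts T; d u = 0\<rbrakk> \<Longrightarrow> u = c"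
    and xyz: "x \<in> verts T" "y \<in> verts T" "z \<in> verts T" "adjacent T x y" "adjacent T x z"
    and dd: "Suc (d y) = d x" "Suc (d z) = d x"
  shows "y = z"
proof (rule ccontr)
  assume yz: "y \<noteq> z"
  define a where "a i = (par ^^ i) y" for i
  define b where "b i = (par ^^ i) z" for i
  have walk: "(par ^^ i) u \<in> verts T \<and> d ((par ^^ i) u) + i = d u" if "u \<in> verts T" "i \<le> d u" for i u
    using that(2) by (induction i) (use par that(1) in fastforce)+
  have a: "a i \<in> verts T" "d (a i) + i = d y" if "i \<le> d y" for i
    using walk[OF xyz(2) that] by (auto simp: a_def)
  have b: "b i \<in> verts T" "d (b i) + i = d y" if "i \<le> d y" for i
    using walk[OF xyz(3)] that dd by (auto simp: b_def)
  have adja: "adjacent T (a i) (a (Suc i))" if "i < d y" for i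
    using par[OF a(1), of i] a(2)[of i] that by (simp add: a_def)
  have adjb: "adjacent T (b i) (b (Suc i))" if "i < d y" for i
    using par[OF b(1), of i] b(2)[of i] that by (simp add: b_def)
  have "a (d y) = c" "b (d y) = c" using d0 a[of "d y"] b[of "d y"] by auto
  then have meet: "a (d y) = b (d y)" by simp
  define m where "m = (LEAST i. a i = b i)"
  have m: "a m = b m" "m \<le> d y" "\<And>i. i < m \<Longrightarrow> a i \<noteq> b i"
    unfolding m_def using meet LeastI[of "\<lambda>i. a i = b i"] Least_le[of "\<lambda>i. a i = b i"] not_less_Least by auto
  have m0: "0 < m" using m(1) yz by (cases m) (auto simp: a_def b_def)
  \<comment> \<open>from \<open>x\<close> down along the first walk to the meeting point, then back up the second walk\<close>
  define p where "p = x # map a [0..<m] @ map b (rev [0..<Suc m])"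
  have lp: "length p = 2 * m + 2" by (simp add: p_def)
  have p0: "p ! 0 = x" by (simp add: p_def)
  have pa: "p ! Suc i = a i" if "i < m" for i using that by (simp add: p_def nth_append)
  have pb: "p ! Suc (m + i) = b (m - i)" if "i \<le> m" for i
    using that by (simp add: p_def nth_append rev_nth del: upt_Suc)
  have hd: "hd p = x" by (simp add: p_def)
  have last: "last p = z"
  proof -
    have "last p = p ! (length p - 1)" using lp by (intro last_conv_nth) auto
    also have "length p - 1 = Suc (m + m)" using lp by simp
    finally show ?thesis using pb[of m] by (simp add: b_def)
  qed
  have dist: "distinct p"
  proof -
    have inja: "inj_on a {0..<m}"
      using a(2) m(2) by (intro inj_onI) (metis add_left_cancel atLeastLessThan_iff less_imp_le order_trans)
    have injb: "inj_on b {0..<Suc m}"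
      using b(2) m(2) by (intro inj_onI) (metis add_left_cancel atLeastLessThan_iff less_Suc_eq_le order_trans)
    have ab: "a i \<noteq> b j" if "i < m" "j \<le> m" for i j
    proof
      assume "a i = b j"
      moreover from this have "i = j" using a(2)[of i] b(2)[of j] that m(2) by simp
      ultimately show False using m(3) that by blast
    qed
    have notx: "a i \<noteq> x" "b i \<noteq> x" if "i \<le> m" for i
      using a(2)[of i] b(2)[of i] that m(2) dd by auto
    have "x \<notin> a ` {0..<m}"
    proof
      assume "x \<in> a ` {0..<m}"
      then obtain i where "i < m" "x = a i" by auto
      then show False using notx(1)[of i] by simp
    qed
    moreover have "x \<notin> b ` {0..<Suc m}"
    proof
      assume "x \<in> b ` {0..<Suc m}"
      then obtain i where "i \<le> m" "x = b i" by (auto simp: less_Suc_eq_le simp del: atLeastLessThanSuc)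
      then show False using notx(2)[of i] by simp
    qed
    moreover
    have "a ` {0..<m} \<inter> b ` {0..<Suc m} = {}" using ab by (auto simp: less_Suc_eq_le simp del: atLeastLessThanSuc)
    ultimately show ?thesis using inja injb
      by (simp add: p_def distinct_map del: upt_Suc)
  qed
  have verts: "set p \<subseteq> verts T"
    using xyz a(1) b(1) m(2) by (auto simp: p_def less_Suc_eq_le simp del: upt_Suc)
  have adj: "adjacent T (p ! i) (p ! Suc i)" if "Suc i < length p" for i
  proof -
    consider "i = 0" | "0 < i" "i < m" | "i = m" | "m < i" by linarith
    then show ?thesis
    proof cases
      case 1
      then show ?thesis using pa[of 0] m0 p0 xyz by (simp add: a_def)
    next
      case 2
      then obtain j where j: "i = Suc j" by (cases i) auto
      then show ?thesis using pa[of j] pa[of i] 2 adja[of j] m(2) by simp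
    next
      case 3
      then obtain j where j: "i = Suc j" using m0 by (cases i) auto
      then show ?thesis using pa[of j] pb[of 0] 3 adja[of j] m by auto
    next
      case 4
      then obtain j where j: "i = Suc (m + j)" using less_imp_Suc_add by blast
      then have jm: "j < m" using that lp by simp
      then have e: "m - j = Suc (m - Suc j)" by simp
      have "adjacent T (b (Suc (m - Suc j))) (b (m - Suc j))"
        using adjb[of "m - Suc j"] m(2) jm adjacent_commute[of T] by simp
      then show ?thesis using pb[of j] pb[of "Suc j"] jm j e by simp
    qed
  qed
  have "is_cycle T p"
    unfolding is_cycle_def is_path_def
    using lp m0 dist verts adj hd last xyz(5) adjacent_commute[of T] by auto
  then show False using noc by blast
qed

text \<open>
Let \<open>c\<close> be a centre and let the level be \<open>r\<close> minus the distance to \<open>c\<close>. Adjacent vertices cannot have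
equal distances because the distance has the parity of the side.
\<close>

lemma tree_leveled:
  fixes T :: "('a, 'b) bigraph_scheme"
  assumes big: "bigraph T" and tree: "is_tree T" and r: "radius T = r" and t: "2 \<le> card (verts T)"
  shows "1 \<le> r" "r \<le> card (verts T)"
    "\<exists>lev c. leveled_tree (verts T) (\<lambda>x y. x \<in> verts T \<and> y \<in> verts T \<and> adjacent T x y) lev \<and>
      (\<forall>x\<in>verts T. lev x \<le> r) \<and> c \<in> verts T \<and>
      leveled_tree.desc (verts T) (\<lambda>x y. x \<in> verts T \<and> y \<in> verts T \<and> adjacent T x y) lev c = verts T"
proof -
  let ?V = "verts T"
  let ?TE = "\<lambda>x y. x \<in> verts T \<and> y \<in> verts T \<and> adjacent T x y"
  define near where "near k \<longleftrightarrow> (\<exists>v\<in>?V. \<forall>w\<in>?V. \<exists>p. is_path T w p v \<and> length p - 1 \<le> k)" for k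
  have finV: "finite ?V" using big by (simp add: bigraph_def sgraph_def)
  have conn: "is_connected T" and noc: "\<nexists>p. is_cycle T p" using tree by (auto simp: is_tree_def)
  obtain v0 where v0: "v0 \<in> ?V" using t by fastforce
  have "near (card ?V)" unfolding near_def
  proof (intro bexI[OF _ v0] ballI)
    fix w assume "w \<in> ?V"
    then obtain p where p: "is_path T w p v0" using conn v0 by (auto simp: is_connected_def)
    then have "length p = card (set p)" "set p \<subseteq> ?V" by (auto simp: is_path_def distinct_card)
    then have "length p \<le> card ?V" using finV by (simp add: card_mono)
    then show "\<exists>p. is_path T w p v0 \<and> length p - 1 \<le> card ?V" using p by auto
  qed
  moreover have "r = (LEAST k. near k)" using r by (simp add: radius_def near_def)
  ultimately have "near r" and r_le: "r \<le> card ?V"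
    by (auto intro: LeastI Least_le)
  then obtain c where c: "c \<in> ?V" and cr: "\<And>w. w \<in> ?V \<Longrightarrow> \<exists>p. is_path T w p c \<and> length p - 1 \<le> r"
    by (auto simp: near_def)
  show "r \<le> card ?V" by (rule r_le)
  define d where "d x = (LEAST k. (x, c) \<in> edge_rel T ^^ k)" for x
  have dI: "(x, c) \<in> edge_rel T ^^ d x" if "x \<in> ?V" for x
    unfolding d_def using cr[OF that] is_path_relpow by (metis LeastI)
  have d_le: "d x \<le> k" if "(x, c) \<in> edge_rel T ^^ k" for x k
    unfolding d_def using that by (rule Least_le)
  have dr: "d x \<le> r" if "x \<in> ?V" for x
    using cr[OF that] is_path_relpow d_le order_trans by metis
  have d0: "u = c" if "u \<in> ?V" "d u = 0" for u using dI[OF that(1)] that(2) by simp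
  have d_edge: "d x \<le> Suc (d y)" if "x \<in> ?V" "y \<in> ?V" "adjacent T x y" for x y
    using d_le[of x "Suc (d y)"] relpow_Suc_I2[of x y "edge_rel T" c "d y"] dI[OF that(2)] that
    by (simp add: edge_rel_def)
  have ex_par: "\<exists>y\<in>?V. adjacent T u y \<and> Suc (d y) = d u" if u: "u \<in> ?V" "0 < d u" for u
  proof -
    obtain k where k: "d u = Suc k" using u(2) by (cases "d u") auto
    obtain y where y: "(u, y) \<in> edge_rel T" "(y, c) \<in> edge_rel T ^^ k"
      using dI[OF u(1)] relpow_Suc_E2 unfolding k by metis
    then have "y \<in> ?V" "adjacent T u y" by (auto simp: edge_rel_def)
    moreover have "d y \<le> k" using d_le y by blast
    ultimately show ?thesis using d_edge[of u y] u(1) k by force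
  qed
  define par where "par u = (SOME y. y \<in> ?V \<and> adjacent T u y \<and> Suc (d y) = d u)" for u
  have par: "par u \<in> ?V \<and> adjacent T u (par u) \<and> Suc (d (par u)) = d u" if "u \<in> ?V" "0 < d u" for u
    unfolding par_def using ex_par[OF that] by (intro someI_ex[of "\<lambda>y. y \<in> ?V \<and> adjacent T u y \<and> Suc (d y) = d u"]) blast
  have side: "(x \<in> part1 T) = (y \<notin> part1 T)" if "adjacent T x y" for x y
  proof -
    have "{x, y} \<in> edges T" using that by (simp add: adjacent_def)
    then obtain u w where "u \<in> part1 T" "w \<in> part2 T" "{x, y} = {u, w}"
      using bigraph.edges_across[OF big] by blast
    then show ?thesis using bigraph.parts_disjoint[OF big] by (auto simp: doubleton_eq_iff)
  qed
  have parity: "(x \<in> part1 T \<longleftrightarrow> y \<in> part1 T) = even k" if "(x, y) \<in> edge_rel T ^^ k" for x y k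
    using that
  proof (induction k arbitrary: y)
    case (Suc k)
    then obtain w where "(x, w) \<in> edge_rel T ^^ k" "(w, y) \<in> edge_rel T" by auto
    then show ?case using Suc.IH[of w] side[of w y] by (auto simp: edge_rel_def)
  qed auto
  have d_diff: "d x = Suc (d y) \<or> d y = Suc (d x)" if "x \<in> ?V" "y \<in> ?V" "adjacent T x y" for x y
  proof -
    have "even (d x) \<noteq> even (d y)"
      using parity[OF dI] parity[OF dI] that side by metis
    then have "d x \<noteq> d y" by metis
    then show ?thesis using d_edge[of x y] d_edge[of y x] that adjacent_commute[of T] by fastforce
  qed
  define lev where "lev x = r - d x" for x
  have levS: "lev x = Suc (lev y) \<longleftrightarrow> d y = Suc (d x)" if "x \<in> ?V" "y \<in> ?V" for x y
    using dr[OF that(1)] dr[OF that(2)] by (auto simp: lev_def)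
  interpret L: leveled_tree ?V ?TE lev
  proof
    show "finite ?V" by (rule finV)
    show "?TE x y \<Longrightarrow> ?TE y x" for x y using adjacent_commute by metis
    show "lev x = Suc (lev y) \<or> lev y = Suc (lev x)" if "x \<in> ?V" "y \<in> ?V" "?TE x y" for x y
      using d_diff[of x y] levS that by blast
    show "x = x'" if "x \<in> ?V" "x' \<in> ?V" "y \<in> ?V" "?TE x y" "?TE x' y"
      "lev x = Suc (lev y)" "lev x' = Suc (lev y)" for x x' y
      using tree_no_two_descents[OF noc par d0, of y x x'] that levS adjacent_commute[of T] by metis
  qed
  have "x \<in> L.desc c" if "x \<in> ?V" for x
    using that
  proof (induction "d x" arbitrary: x)
    case 0
    then show ?case using d0[of x] by simp
  next
    case (Suc k)
    then have px: "par x \<in> ?V" "adjacent T x (par x)" "Suc (d (par x)) = d x" using par[of x] by auto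
    then have "par x \<in> L.desc c" using Suc by simp
    moreover have "x \<in> L.children (par x)"
      using px Suc.prems levS[of "par x" x] adjacent_commute[of T] by (auto simp: L.children_def)
    ultimately show ?case using L.desc_step px(1) by blast
  qed
  then have "L.desc c = ?V" using L.desc_subset[OF c] by blast
  then show "\<exists>lev c. leveled_tree ?V ?TE lev \<and> (\<forall>x\<in>?V. lev x \<le> r) \<and> c \<in> ?V \<and>
      leveled_tree.desc ?V ?TE lev c = ?V"
    using L.leveled_tree_axioms c by (intro exI[of _ lev] exI[of _ c]) (auto simp: lev_def)
  show "1 \<le> r"
  proof (rule ccontr)
    assume "\<not> 1 \<le> r"
    then have "x = c" if "x \<in> ?V" for x using dr[OF that] d0[OF that] by simp
    then have "?V = {c}" using c by blast
    then show False using t by simp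
  qed
qed

section \<open>Ordered bigraphs and blocks\<close>

definition rank :: "'a rel \<Rightarrow> 'a set \<Rightarrow> 'a \<Rightarrow> nat" where
  "rank q A a = card {b \<in> A. (b, a) \<in> q \<and> b \<noteq> a}"

lemma linear_order_on_total:
  "\<lbrakk>linear_order_on A q; a \<in> A; b \<in> A; a \<noteq> b\<rbrakk> \<Longrightarrow> (a, b) \<in> q \<or> (b, a) \<in> q"
  by (auto simp: linear_order_on_def total_on_def)

lemma rank_mono:
  assumes q: "linear_order_on S q" and A: "A \<subseteq> S" "finite A"
    and ab: "a \<in> A" "b \<in> A" "(a, b) \<in> q" "a \<noteq> b"
  shows "rank q A a < rank q A b"
proof -
  have tr: "trans q" and anti: "antisym q"
    using q by (auto simp: linear_order_on_def partial_order_on_def preorder_on_def)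
  have "{c \<in> A. (c, a) \<in> q \<and> c \<noteq> a} \<subset> {c \<in> A. (c, b) \<in> q \<and> c \<noteq> b}"
  proof
    show "{c \<in> A. (c, a) \<in> q \<and> c \<noteq> a} \<subseteq> {c \<in> A. (c, b) \<in> q \<and> c \<noteq> b}"
      using ab tr anti by (auto dest: transD antisymD)
    show "{c \<in> A. (c, a) \<in> q \<and> c \<noteq> a} \<noteq> {c \<in> A. (c, b) \<in> q \<and> c \<noteq> b}"
      using ab by blast
  qed
  then show ?thesis unfolding rank_def using A(2) by (intro psubset_card_mono) auto
qed

lemma rank_less_iff:
  assumes "linear_order_on S q" "A \<subseteq> S" "finite A" "a \<in> A" "b \<in> A"
  shows "rank q A a < rank q A b \<longleftrightarrow> (a, b) \<in> q \<and> a \<noteq> b"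
proof
  assume l: "rank q A a < rank q A b"
  then have "a \<noteq> b" by auto
  moreover have "(b, a) \<notin> q" using rank_mono[OF assms(1-3,5,4)] l \<open>a \<noteq> b\<close> by fastforce
  ultimately show "(a, b) \<in> q \<and> a \<noteq> b"
    using linear_order_on_total[OF assms(1), of a b] assms by blast
qed (use rank_mono[OF assms] in simp)

lemma rank_bij:
  assumes q: "linear_order_on S q" and A: "A \<subseteq> S" "finite A"
  shows "bij_betw (rank q A) A {..<card A}"
proof -
  have inj: "inj_on (rank q A) A"
  proof (rule inj_onI)
    fix a b assume ab: "a \<in> A" "b \<in> A" "rank q A a = rank q A b"
    then show "a = b"
      using rank_mono[OF q A, of a b] rank_mono[OF q A, of b a] linear_order_on_total[OF q, of a b] A
      by fastforce
  qed
  have "rank q A a < card A" if "a \<in> A" for a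
    unfolding rank_def using that A(2) by (intro psubset_card_mono) auto
  then have "rank q A ` A \<subseteq> {..<card A}" by auto
  then have "rank q A ` A = {..<card A}"
    using inj by (intro card_subset_eq) (auto simp: card_image)
  then show ?thesis using inj by (simp add: bij_betw_def)
qed

text \<open>
Consecutive intervals of \<open>s\<close> elements of \<open>A\<close>, distributed in the order of \<open>I\<close>.
\<close>

lemma ordered_blocks:
  assumes p: "linear_order_on I p" "finite I" and q: "linear_order_on S q" "A \<subseteq> S" "finite A"
    and s: "s * card I \<le> card A"
  obtains W where "\<And>i. i \<in> I \<Longrightarrow> W i \<subseteq> A" "\<And>i. i \<in> I \<Longrightarrow> card (W i) = s"
    "\<And>i j a b. \<lbrakk>i \<in> I; j \<in> I; i \<noteq> j; (i, j) \<in> p; a \<in> W i; b \<in> W j\<rbrakk> \<Longrightarrow> (a, b) \<in> q \<and> a \<noteq> b"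
proof -
  define W where "W i = {a \<in> A. rank q A a \<in> {s * rank p I i..<s * rank p I i + s}}" for i
  have cW: "card (W i) = s" if i: "i \<in> I" for i
  proof -
    have "rank p I i < card I" using rank_bij[OF p(1) order.refl p(2)] i by (auto simp: bij_betw_def)
    then have "s * (rank p I i + 1) \<le> s * card I" by (intro mult_le_mono) auto
    then have sub: "{s * rank p I i..<s * rank p I i + s} \<subseteq> {..<card A}" using s by auto
    have "W i \<subseteq> A" by (auto simp: W_def)
    moreover have "rank q A ` W i = {s * rank p I i..<s * rank p I i + s}"
    proof -
      have "rank q A ` W i = rank q A ` A \<inter> {s * rank p I i..<s * rank p I i + s}"
        unfolding W_def by (auto simp del: atLeastLessThan_iff)
      then show ?thesis
        unfolding bij_betw_imp_surj_on[OF rank_bij[OF q]] using sub by (simp only: Int_absorb1)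
    qed
    ultimately have "bij_betw (rank q A) (W i) {s * rank p I i..<s * rank p I i + s}"
      by (rule bij_betw_subset[OF rank_bij[OF q]])
    from bij_betw_same_card[OF this] show ?thesis by simp
  qed
  show ?thesis
  proof (rule that[of W])
    fix i j a b
    assume ij: "i \<in> I" "j \<in> I" "i \<noteq> j" "(i, j) \<in> p" and ab: "a \<in> W i" "b \<in> W j"
    then have "rank p I i < rank p I j" using rank_less_iff[OF p(1) order.refl p(2)] by blast
    then have "s * (rank p I i + 1) \<le> s * rank p I j" by (intro mult_le_mono) auto
    then have "rank q A a < rank q A b" using ab by (auto simp: W_def)
    then show "(a, b) \<in> q \<and> a \<noteq> b" using rank_less_iff[OF q] ab by (auto simp: W_def)
  qed (use cW in \<open>auto simp: W_def\<close>)
qed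

definition separated :: "('a, 'c) ordered_bigraph_scheme \<Rightarrow> ('b, 'd) ordered_bigraph_scheme \<Rightarrow>
    ('a \<Rightarrow> 'b set) \<Rightarrow> bool" where
  "separated T G W \<longleftrightarrow>
    (\<forall>x\<in>part1 T. W x \<subseteq> part1 G) \<and> (\<forall>x\<in>part2 T. W x \<subseteq> part2 G) \<and>
    (\<forall>x\<in>part1 T. \<forall>y\<in>part1 T. x \<noteq> y \<and> (x, y) \<in> order1 T \<longrightarrow>
      (\<forall>a\<in>W x. \<forall>b\<in>W y. (a, b) \<in> order1 G \<and> a \<noteq> b)) \<and>
    (\<forall>x\<in>part2 T. \<forall>y\<in>part2 T. x \<noteq> y \<and> (x, y) \<in> order2 T \<longrightarrow>
      (\<forall>a\<in>W x. \<forall>b\<in>W y. (a, b) \<in> order2 G \<and> a \<noteq> b))"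

lemma separated_order:
  assumes p: "linear_order_on I p" and q: "linear_order_on S q"
    and sep: "\<forall>x\<in>I. \<forall>y\<in>I. x \<noteq> y \<and> (x, y) \<in> p \<longrightarrow> (\<forall>a\<in>W x. \<forall>b\<in>W y. (a, b) \<in> q \<and> a \<noteq> b)"
    and WS: "\<forall>x\<in>I. W x \<subseteq> S" and f: "\<forall>x\<in>I. f x \<in> W x" and uv: "u \<in> I" "v \<in> I"
  shows "(u, v) \<in> p \<longleftrightarrow> (f u, f v) \<in> q" and "f u = f v \<Longrightarrow> u = v"
proof -
  have anti: "antisym q" and refl: "refl_on I p" "refl_on S q"
    using p q by (auto simp: linear_order_on_def partial_order_on_def preorder_on_def)
  have fu: "f u \<in> S" using f WS uv by blast
  consider "u = v" | "u \<noteq> v" "(u, v) \<in> p" | "u \<noteq> v" "(u, v) \<notin> p" "(v, u) \<in> p"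
    using linear_order_on_total[OF p uv] by blast
  then have *: "((u, v) \<in> p \<longleftrightarrow> (f u, f v) \<in> q) \<and> (f u = f v \<longrightarrow> u = v)"
  proof cases
    case 1
    then show ?thesis using refl uv fu by (auto simp: refl_on_def)
  next
    case 2
    then show ?thesis using sep f uv by auto
  next
    case 3
    then have "(f v, f u) \<in> q \<and> f v \<noteq> f u" using sep f uv by auto
    then show ?thesis using 3 anti by (metis antisymD)
  qed
  show "(u, v) \<in> p \<longleftrightarrow> (f u, f v) \<in> q" and "f u = f v \<Longrightarrow> u = v" using * by auto
qed

lemma not_adjacent_same_part:
  assumes H: "bigraph H" and uv: "u \<in> part1 H \<and> v \<in> part1 H \<or> u \<in> part2 H \<and> v \<in> part2 H"
  shows "\<not> adjacent H u v"
proof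
  assume "adjacent H u v"
  then have "{u, v} \<in> edges H" by (simp add: adjacent_def)
  from bigraph.edges_across[OF H this]
  obtain a b where "a \<in> part1 H" "b \<in> part2 H" "{u, v} = {a, b}" by blast
  then show False using uv bigraph.parts_disjoint[OF H] by (auto simp: doubleton_eq_iff)
qed

text \<open>
A map that picks one vertex from each block respects the orders, and hence is injective; only the
adjacencies across the bipartition remain to be checked.
\<close>

lemma contains_if_separated:
  assumes T: "ordered_bigraph T" and G: "ordered_bigraph G" and sep: "separated T G W"
    and f: "\<And>x. x \<in> verts T \<Longrightarrow> f x \<in> W x"
    and adj: "\<And>x y. \<lbrakk>x \<in> part1 T; y \<in> part2 T\<rbrakk> \<Longrightarrow> adjacent G (f x) (f y) \<longleftrightarrow> adjacent T x y"
  shows "contains G T"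
proof -
  interpret T: ordered_bigraph T by (rule T)
  interpret G: ordered_bigraph G by (rule G)
  note sep = sep[unfolded separated_def]
  have fW: "\<forall>x\<in>part1 T. f x \<in> W x" "\<forall>x\<in>part2 T. f x \<in> W x" using f T.parts_cover by auto
  have f1: "f x \<in> part1 G" if "x \<in> part1 T" for x using fW(1) conjunct1[OF sep] that by blast
  have f2: "f x \<in> part2 G" if "x \<in> part2 T" for x
    using fW(2) conjunct1[OF conjunct2[OF sep]] that by blast
  note ord1 = separated_order[where W = W and f = f, OF T.linear_order1 G.linear_order1
      conjunct1[OF conjunct2[OF conjunct2[OF sep]]] conjunct1[OF sep] fW(1)]
  note ord2 = separated_order[where W = W and f = f, OF T.linear_order2 G.linear_order2
      conjunct2[OF conjunct2[OF conjunct2[OF sep]]] conjunct1[OF conjunct2[OF sep]] fW(2)]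
  have inj: "inj_on f (verts T)"
  proof (rule inj_onI)
    fix u v assume uv: "u \<in> verts T" "v \<in> verts T" "f u = f v"
    then consider "u \<in> part1 T" "v \<in> part1 T" | "u \<in> part2 T" "v \<in> part2 T"
      | "u \<in> part1 T" "v \<in> part2 T" | "u \<in> part2 T" "v \<in> part1 T"
      using T.parts_cover by blast
    then show "u = v"
    proof cases
      case 1 then show ?thesis using ord1(2) uv(3) by blast
    next
      case 2 then show ?thesis using ord2(2) uv(3) by blast
    next
      case 3 then show ?thesis using f1[of u] f2[of v] uv(3) G.parts_disjoint by auto
    next
      case 4 then show ?thesis using f1[of v] f2[of u] uv(3) G.parts_disjoint by auto
    qed
  qed
  have iso: "graph_iso f T (induced G (f ` verts T))"
    unfolding graph_iso_def
  proof (intro conjI ballI)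
    show "bij_betw f (verts T) (verts (induced G (f ` verts T)))"
      using inj by (simp add: induced_def bij_betw_def)
    fix u v assume uv: "u \<in> verts T" "v \<in> verts T"
    have "adjacent (induced G (f ` verts T)) (f u) (f v) \<longleftrightarrow> adjacent G (f u) (f v)"
      using uv by (auto simp: adjacent_def induced_def)
    moreover have "adjacent G (f u) (f v) \<longleftrightarrow> adjacent T u v"
    proof -
      consider "u \<in> part1 T \<and> v \<in> part1 T \<or> u \<in> part2 T \<and> v \<in> part2 T"
        | "u \<in> part1 T" "v \<in> part2 T" | "u \<in> part2 T" "v \<in> part1 T"
        using T.parts_cover uv by blast
      then show ?thesis
      proof cases
        case 1
        then have "\<not> adjacent T u v" using not_adjacent_same_part[OF T.bigraph_axioms] by blast
        moreover have "\<not> adjacent G (f u) (f v)" using 1 not_adjacent_same_part[OF G.bigraph_axioms] f1 f2 by blast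
        ultimately show ?thesis by blast
      next
        case 2 then show ?thesis by (rule adj)
      next
        case 3 then show ?thesis using adj[of v u] adjacent_commute by metis
      qed
    qed
    ultimately show "adjacent T u v \<longleftrightarrow> adjacent (induced G (f ` verts T)) (f u) (f v)" by simp
  qed
  have "f ` verts T \<subseteq> verts G" using f1 f2 T.parts_cover G.parts_cover by blast
  moreover have "f ` part1 T \<subseteq> part1 G" "f ` part2 T \<subseteq> part2 G" using f1 f2 by blast+
  moreover have "\<forall>u\<in>part1 T. \<forall>v\<in>part1 T. (u, v) \<in> order1 T \<longleftrightarrow> (f u, f v) \<in> order1 G"
    "\<forall>u\<in>part2 T. \<forall>v\<in>part2 T. (u, v) \<in> order2 T \<longleftrightarrow> (f u, f v) \<in> order2 G"
    by (intro ballI ord1(1) ord2(1); assumption)+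
  ultimately show ?thesis
    unfolding contains_def using iso by (intro exI[of _ "f ` verts T"] exI[of _ f] conjI)
qed

lemma bicomplement_simps [simp]:
  "verts (bicomplement T) = verts T" "part1 (bicomplement T) = part1 T" "part2 (bicomplement T) = part2 T"
  "order1 (bicomplement T) = order1 T" "order2 (bicomplement T) = order2 T"
  by (simp_all add: bicomplement_def)

lemma blocks_in_part:
  assumes p: "linear_order_on I p" "finite I" and q: "linear_order_on S q" "A \<subseteq> S" "finite A"
    and M: "M \<le> real (card A)" "real t ^ 2 \<le> M" and I: "card I < t"
  shows "\<exists>W. (\<forall>x\<in>I. W x \<subseteq> A \<and> M / real t \<le> real (card (W x))) \<and>
    (\<forall>x\<in>I. \<forall>y\<in>I. x \<noteq> y \<and> (x, y) \<in> p \<longrightarrow> (\<forall>a\<in>W x. \<forall>b\<in>W y. (a, b) \<in> q \<and> a \<noteq> b))"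
proof -
  \<comment> \<open>rounding up still fits, since there are fewer than \<open>t\<close> blocks and \<open>M\<close> is at least \<open>t\<^sup>2\<close>\<close>
  define s where "s = nat \<lceil>M / real t\<rceil>"
  have t0: "0 < real t" using I by simp
  have tM: "real t \<le> M / real t" using M(2) t0 by (simp add: field_simps power2_eq_square)
  have s: "M / real t \<le> real s" "real s \<le> M / real t + 1" using tM t0 by (auto simp: s_def)
  have "real (s * card I) \<le> (M / real t + 1) * (real t - 1)"
    using s(2) I tM t0 unfolding of_nat_mult by (intro mult_mono) auto
  also have "\<dots> = M - (M / real t - real t + 1)" using t0 by (simp add: field_simps)
  also have "\<dots> \<le> M" using tM by linarith
  also have "\<dots> \<le> real (card A)" by (rule M(1))
  finally have "s * card I \<le> card A" by (simp only: of_nat_le_iff)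
  from ordered_blocks[OF p q this] obtain W where
    W: "\<And>i. i \<in> I \<Longrightarrow> W i \<subseteq> A" "\<And>i. i \<in> I \<Longrightarrow> card (W i) = s"
    "\<And>i j a b. \<lbrakk>i \<in> I; j \<in> I; i \<noteq> j; (i, j) \<in> p; a \<in> W i; b \<in> W j\<rbrakk> \<Longrightarrow> (a, b) \<in> q \<and> a \<noteq> b"
    by metis
  show ?thesis
  proof (intro exI[of _ W] conjI ballI impI)
    show "W x \<subseteq> A" "M / real t \<le> real (card (W x))" if "x \<in> I" for x
      using W(1,2)[OF that] s by auto
  qed (use W(3) in blast)+
qed

lemma separated_blocks:
  assumes T: "ordered_bigraph T" and G: "ordered_bigraph G"
    and ne: "part1 T \<noteq> {}" "part2 T \<noteq> {}"
    and A: "A \<subseteq> part1 G" and B: "B \<subseteq> part2 G"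
    and M: "M \<le> real (card A)" "M \<le> real (card B)" "real (card (verts T)) ^ 2 \<le> M"
  shows "\<exists>W. separated T G W \<and> (\<forall>x\<in>verts T. W x \<subseteq> (if x \<in> part1 T then A else B) \<and>
    M / real (card (verts T)) \<le> real (card (W x)))"
proof -
  interpret T: ordered_bigraph T by (rule T)
  interpret G: ordered_bigraph G by (rule G)
  have fT: "finite (part1 T)" "finite (part2 T)" using T.parts_cover T.finite_verts by (metis finite_Un)+
  have fG: "finite A" "finite B" using G.parts_cover G.finite_verts A B by (metis finite_Un finite_subset)+
  have ct: "card (verts T) = card (part1 T) + card (part2 T)"
    using T.parts_cover T.parts_disjoint fT by (metis card_Un_disjoint)
  have lt: "card (part1 T) < card (verts T)" "card (part2 T) < card (verts T)"
    using ct ne fT by (auto simp: card_gt_0_iff)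
  obtain W1 where W1: "\<forall>x\<in>part1 T. W1 x \<subseteq> A \<and> M / real (card (verts T)) \<le> real (card (W1 x))"
    and S1: "\<forall>x\<in>part1 T. \<forall>y\<in>part1 T. x \<noteq> y \<and> (x, y) \<in> order1 T \<longrightarrow>
        (\<forall>a\<in>W1 x. \<forall>b\<in>W1 y. (a, b) \<in> order1 G \<and> a \<noteq> b)"
    using blocks_in_part[OF T.linear_order1 fT(1) G.linear_order1 A fG(1) M(1,3) lt(1)] by blast
  obtain W2 where W2: "\<forall>x\<in>part2 T. W2 x \<subseteq> B \<and> M / real (card (verts T)) \<le> real (card (W2 x))"
    and S2: "\<forall>x\<in>part2 T. \<forall>y\<in>part2 T. x \<noteq> y \<and> (x, y) \<in> order2 T \<longrightarrow>
        (\<forall>a\<in>W2 x. \<forall>b\<in>W2 y. (a, b) \<in> order2 G \<and> a \<noteq> b)"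
    using blocks_in_part[OF T.linear_order2 fT(2) G.linear_order2 B fG(2) M(2,3) lt(2)] by blast
  define W where "W x = (if x \<in> part1 T then W1 x else W2 x)" for x
  have e1: "W x = W1 x" if "x \<in> part1 T" for x using that by (simp add: W_def)
  have e2: "W x = W2 x" if "x \<in> part2 T" for x using that T.parts_disjoint by (auto simp: W_def)
  have "separated T G W"
    unfolding separated_def
  proof (intro conjI)
    show "\<forall>x\<in>part1 T. W x \<subseteq> part1 G" using W1 A e1 by auto
    show "\<forall>x\<in>part2 T. W x \<subseteq> part2 G" using W2 B e2 by auto
    show "\<forall>x\<in>part1 T. \<forall>y\<in>part1 T. x \<noteq> y \<and> (x, y) \<in> order1 T \<longrightarrow>
        (\<forall>a\<in>W x. \<forall>b\<in>W y. (a, b) \<in> order1 G \<and> a \<noteq> b)" using S1 e1 by simp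
    show "\<forall>x\<in>part2 T. \<forall>y\<in>part2 T. x \<noteq> y \<and> (x, y) \<in> order2 T \<longrightarrow>
        (\<forall>a\<in>W x. \<forall>b\<in>W y. (a, b) \<in> order2 G \<and> a \<noteq> b)" using S2 e2 by simp
  qed
  moreover have "W x \<subseteq> (if x \<in> part1 T then A else B) \<and> M / real (card (verts T)) \<le> real (card (W x))"
    if x: "x \<in> verts T" for x
  proof (cases "x \<in> part1 T")
    case True then show ?thesis using W1 e1 by simp
  next
    case False
    then have "x \<in> part2 T" using x T.parts_cover by blast
    then show ?thesis using W2 e2 False by simp
  qed
  ultimately show ?thesis by blast
qed

lemma bicomplement_ordered_bigraph:
  assumes "ordered_bigraph T" shows "ordered_bigraph (bicomplement T)"
proof -
  interpret T: ordered_bigraph T by (rule assms)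
  have e: "edges (bicomplement T) = {{u, v} |u v. u \<in> part1 T \<and> v \<in> part2 T \<and> \<not> adjacent T u v}"
    by (simp add: bicomplement_def)
  show ?thesis
  proof
    show "finite (verts (bicomplement T))" using T.finite_verts by simp
    show "e \<subseteq> verts (bicomplement T) \<and> card e = 2" if edge: "e \<in> edges (bicomplement T)" for e
    proof -
      obtain u v where uv: "e = {u, v}" "u \<in> part1 T" "v \<in> part2 T" using edge unfolding e by blast
      then have "u \<noteq> v" using T.parts_disjoint by blast
      then show ?thesis using uv T.parts_cover by auto
    qed
    show "\<exists>u\<in>part1 (bicomplement T). \<exists>v\<in>part2 (bicomplement T). e = {u, v}"
      if "e \<in> edges (bicomplement T)" for e
      using that unfolding e by auto
  qed (use T.parts_disjoint T.parts_cover T.linear_order1 T.linear_order2 in simp_all)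
qed

lemma adjacent_bicomplement:
  assumes "bigraph T" "x \<in> part1 T" "y \<in> part2 T"
  shows "adjacent (bicomplement T) x y \<longleftrightarrow> \<not> adjacent T x y"
proof -
  have "part1 T \<inter> part2 T = {}" by (rule bigraph.parts_disjoint[OF assms(1)])
  then have "{x, y} = {u, v} \<and> u \<in> part1 T \<and> v \<in> part2 T \<longleftrightarrow> u = x \<and> v = y" for u v
    using assms(2,3) by (auto simp: doubleton_eq_iff)
  moreover have "adjacent (bicomplement T) x y \<longleftrightarrow>
      (\<exists>u v. ({x, y} = {u, v} \<and> u \<in> part1 T \<and> v \<in> part2 T) \<and> \<not> adjacent T u v)"
    by (simp add: bicomplement_def adjacent_def)
  ultimately show ?thesis by simp
qed

text \<open>
The truth value \<open>pos\<close> selects the graph or its bicomplement, so that the sparse and the dense case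
can be treated together.
\<close>

lemma contains_of_copy:
  assumes T: "ordered_bigraph T" and G: "ordered_bigraph G" and sep: "separated T G W"
    and f: "\<And>x. x \<in> verts T \<Longrightarrow> f x \<in> W x"
    and adj: "\<And>x y. \<lbrakk>x \<in> part1 T; y \<in> part2 T\<rbrakk> \<Longrightarrow> (adjacent G (f x) (f y) = pos) \<longleftrightarrow> adjacent T x y"
  shows "contains G T \<or> contains G (bicomplement T)"
proof (cases pos)
  case True
  then show ?thesis using contains_if_separated[OF T G sep f] adj by blast
next
  case False
  have T': "bigraph T" using T by (simp add: ordered_bigraph_def)
  have "contains G (bicomplement T)"
  proof (rule contains_if_separated[OF bicomplement_ordered_bigraph[OF T] G])
    show "separated (bicomplement T) G W" using sep by (simp add: separated_def)
    show "f x \<in> W x" if "x \<in> verts (bicomplement T)" for x using f that by simp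
    show "adjacent G (f x) (f y) \<longleftrightarrow> adjacent (bicomplement T) x y"
      if "x \<in> part1 (bicomplement T)" "y \<in> part2 (bicomplement T)" for x y
      using adj[of x y] adjacent_bicomplement[OF T', of x y] that False by auto
  qed
  then show ?thesis ..
qed

section \<open>The pure pair\<close>

text \<open>
The assumption that the bound exceeds 1 is what makes \<open>K \<ge> 5\<close> and \<open>n\<close> large compared with \<open>t\<close>.
For the sparse pair, the degree bound \<open>\<Delta>\<close> is at most \<open>n\<close>, so \<open>\<Delta> powr (2/K)\<close> is at most
\<open>t powr (2 K ^ (r - 1))\<close>: these are the remaining two of the five \<open>K ^ (r - 1)\<close>.
\<close>

lemma large_pure_pair:
  fixes T :: "'a ordered_bigraph" and G :: "'b ordered_bigraph" and r t n :: nat and K p :: real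
  assumes tree: "ordered_tree_bigraph T" and rad: "radius T = r" and t: "card (verts T) = t" "2 \<le> t"
    and G: "ordered_bigraph G" and noT: "\<not> contains G T" "\<not> contains G (bicomplement T)"
    and cG: "n \<le> card (part1 G)" "n \<le> card (part2 G)"
    and K: "0 \<le> K" "real t powr (K ^ r) = real n"
    and p_def: "p = (16 * real t ^ 2) powr (- real t) * real n * real t powr (- 5 * K ^ (r - 1))"
    and p1: "1 < p"
  shows "\<exists>Z1 Z2. pure_pair G Z1 Z2 \<and> Z1 \<subseteq> part1 G \<and> Z2 \<subseteq> part2 G \<and>
    p \<le> real (card Z1) \<and> p \<le> real (card Z2)"
proof (rule ccontr)
  assume none: "\<not> ?thesis"
  have T: "ordered_bigraph T" and treeT: "is_tree T" using tree by (auto simp: ordered_tree_bigraph_def)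
  interpret T: ordered_bigraph T by (rule T)
  interpret G: ordered_bigraph G by (rule G)
  let ?V = "verts T"
  let ?TE = "\<lambda>x y. x \<in> verts T \<and> y \<in> verts T \<and> adjacent T x y"
  have r: "1 \<le> r" "r \<le> card ?V" using tree_leveled(1,2)[OF T.bigraph_axioms treeT rad] t by auto
  obtain lev c where lt: "leveled_tree ?V ?TE lev" and lev: "\<And>x. x \<in> ?V \<Longrightarrow> lev x \<le> r"
    and c: "c \<in> ?V" "leveled_tree.desc ?V ?TE lev c = ?V"
    using tree_leveled(3)[OF T.bigraph_axioms treeT rad] t by auto
  define U where "U = real t"
  have U2: "2 \<le> U" using t by (simp add: U_def)
  define L where "L = K ^ (r - 1)"
  have KL: "K ^ r = K * L" using r by (simp add: L_def power_eq_if)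
  have L0: "0 \<le> L" using K by (simp add: L_def)
  define F where "F = (16 * U\<^sup>2) powr (- U)"
  have pF: "p = F * real n * U powr (- 5 * L)" by (simp add: p_def F_def U_def L_def)
  have U16: "16 * U \<le> 16 * U\<^sup>2" "16 \<le> 16 * U\<^sup>2"
    using U2 power_increasing[of 1 2 U] one_le_power[of U 2] by auto
  have F1: "F \<le> (16 * U\<^sup>2) powr (- 1)"
    unfolding F_def using U16 U2 by (intro powr_mono) auto
  have "(16 * U\<^sup>2) powr 1 = 16 * U\<^sup>2" using U16 by (intro powr_one) linarith
  then have F2: "F \<le> 1 / (16 * U\<^sup>2)" using F1 by (simp only: powr_minus_divide)
  have n0: "0 < real n" using p1 pF by (cases "n = 0") auto
  have "1 / (16 * U\<^sup>2) \<le> 1 / 1" using U16 U2 by (intro divide_left_mono) auto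
  then have F3: "F \<le> 1" using F2 by linarith
  have nU: "1 < real n * U powr (- 5 * L)"
  proof -
    have "F * (real n * U powr (- 5 * L)) \<le> 1 * (real n * U powr (- 5 * L))"
      using F3 n0 by (intro mult_right_mono) auto
    then show ?thesis using p1 pF by (simp add: mult.assoc)
  qed
  have nU': "real n = U powr (K * L)" using K KL by (simp add: U_def)
  have K5: "5 \<le> K"
  proof (rule ccontr)
    assume "\<not> 5 \<le> K"
    then have "K * L \<le> 5 * L" using L0 by (intro mult_right_mono) auto
    have "real n * U powr (- 5 * L) = U powr (K * L - 5 * L)"
      by (simp add: nU' powr_diff powr_minus divide_inverse)
    also have "\<dots> \<le> U powr 0" using \<open>K * L \<le> 5 * L\<close> U2 by (intro powr_mono) auto
    finally show False using nU U2 by simp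
  qed
  have L1: "1 \<le> L" unfolding L_def using K5 by (intro one_le_power) auto
  have Fn: "F * real n = p * U powr (5 * L)"
    using U2 by (simp add: pF powr_minus divide_inverse mult.assoc)
  have U5: "U ^ 5 \<le> U powr (5 * L)"
  proof -
    have "U powr 5 \<le> U powr (5 * L)" using L1 U2 by (intro powr_mono) auto
    then show ?thesis using U2 by (simp add: powr_numeral)
  qed
  have U4: "U ^ 4 \<le> U ^ 5" using U2 by (intro power_increasing) auto
  have U0: "1 \<le> U ^ 4" using U2 by (intro one_le_power) auto
  have n_large: "2 * t\<^sup>2 \<le> n"
  proof -
    have "1 \<le> U powr (5 * L)" using U5 U4 U0 by linarith
    then have "p * 1 \<le> p * U powr (5 * L)" using p1 by (intro mult_left_mono) auto
    then have "1 < F * real n" using p1 unfolding Fn by linarith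
    also have "F * real n \<le> 1 / (16 * U\<^sup>2) * real n" using F2 n0 by (intro mult_right_mono) auto
    finally have "16 * U\<^sup>2 \<le> real n" using U2 by (simp add: field_simps)
    then have "2 * U\<^sup>2 \<le> real n" using U16 by linarith
    then show ?thesis unfolding U_def by (metis of_nat_le_iff of_nat_mult of_nat_numeral of_nat_power)
  qed
  have fT: "finite (part1 T)" "finite (part2 T)" using T.parts_cover T.finite_verts by (metis finite_Un)+
  have ct: "t = card (part1 T) + card (part2 T)"
    using T.parts_cover T.parts_disjoint fT t by (metis card_Un_disjoint)
  have fG: "finite (part1 G)" "finite (part2 G)" using G.parts_cover G.finite_verts by (metis finite_Un)+
  have ne: "part1 T \<noteq> {}" "part2 T \<noteq> {}"
  proof -
    have "leveled_tree.children ?V ?TE lev c \<noteq> {}"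
    proof
      assume "leveled_tree.children ?V ?TE lev c = {}"
      then have "?V = {c}" using leveled_tree.desc_unfold[OF lt c(1)] c(2) by simp
      then show False using t by simp
    qed
    then obtain y where "y \<in> leveled_tree.children ?V ?TE lev c" by blast
    then have "adjacent T c y" by (simp add: leveled_tree.children_def[OF lt])
    then have "{c, y} \<in> edges T" by (simp add: adjacent_def)
    then show "part1 T \<noteq> {}" "part2 T \<noteq> {}" using T.edges_across by blast+
  qed
  have nT: "real t ^ 2 \<le> real n"
  proof -
    have "t\<^sup>2 \<le> n" using n_large by linarith
    then show ?thesis by (metis of_nat_le_iff of_nat_power)
  qed
  obtain W where sepW: "separated T G W" and W: "\<And>x. x \<in> ?V \<Longrightarrow> W x \<subseteq> (if x \<in> part1 T then part1 G else part2 G)"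
    and cW: "\<And>x. x \<in> ?V \<Longrightarrow> real n / real t \<le> real (card (W x))"
    using separated_blocks[OF T G ne order.refl order.refl, of "real n"] cG nT t by (auto simp: of_nat_le_iff)
  have W1: "W x \<subseteq> part1 G" if "x \<in> part1 T" for x using W[of x] that T.parts_cover by auto
  have W2: "W x \<subseteq> part2 G" if "x \<in> part2 T" for x
  proof -
    have "x \<in> ?V" "x \<notin> part1 T" using that T.parts_cover T.parts_disjoint by auto
    then show ?thesis using W[of x] by simp
  qed
  have finW: "finite (W x)" if "x \<in> ?V" for x
  proof -
    consider "x \<in> part1 T" | "x \<in> part2 T" using \<open>x \<in> ?V\<close> T.parts_cover by blast
    then show ?thesis
    proof cases
      case 1 then show ?thesis using finite_subset[OF W1 fG(1)] by simp
    next
      case 2 then show ?thesis using finite_subset[OF W2 fG(2)] by simp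
    qed
  qed
  have no_copy: "\<not> ((\<forall>x\<in>?V. f x \<in> W' x) \<and> (\<forall>x\<in>part1 T. \<forall>y\<in>part2 T. (adjacent G (f x) (f y) = pos) \<longleftrightarrow> adjacent T x y))"
    if "separated T G W'" for f W' pos
    using contains_of_copy[OF T G that, of f pos] noT by blast
  obtain A B N pos where A: "A \<subseteq> part1 G" "N \<le> real (card A)" and B: "B \<subseteq> part2 G" "N \<le> real (card B)"
    and degA: "\<And>a. a \<in> A \<Longrightarrow> real (card {b \<in> B. adjacent G a b = pos}) \<le> N / (64 * real t ^ 4)"
    and degB: "\<And>b. b \<in> B \<Longrightarrow> real (card {a \<in> A. adjacent G a b = pos}) \<le> N / (64 * real t ^ 4)"
    and N: "64 * real t ^ 2 * (real n * F) \<le> N" "N \<le> real n"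
  proof (cases "card (part1 T) \<le> card (part2 T)")
    case True
    show ?thesis
    proof (rule sparse_or_dense_pair[where I = "part1 T" and J = "part2 T" and W = W and n = n and t = t
          and R = "adjacent G" and Q = "adjacent T"])
      show "\<nexists>f. (\<forall>x\<in>part1 T \<union> part2 T. f x \<in> W x) \<and>
          (\<forall>i\<in>part1 T. \<forall>j\<in>part2 T. adjacent G (f i) (f j) \<longleftrightarrow> adjacent T i j)"
        using no_copy[OF sepW, of _ True] T.parts_cover by simp
      fix i j X Y N pos
      assume "i \<in> part1 T" "j \<in> part2 T" "X \<subseteq> W i" "Y \<subseteq> W j"
        and "N \<le> real (card X)" "N \<le> real (card Y)"
        "\<And>a. a \<in> X \<Longrightarrow> real (card {b \<in> Y. adjacent G a b = pos}) \<le> N / (64 * real t ^ 4)"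
        "\<And>b. b \<in> Y \<Longrightarrow> real (card {a \<in> X. adjacent G a b = pos}) \<le> N / (64 * real t ^ 4)"
        "64 * real t ^ 2 * (real n * (16 * real t ^ 2) powr (- real t)) \<le> N" "N \<le> real n"
      then show ?thesis using that[of X N Y pos] W1[of i] W2[of j] by (auto simp: F_def U_def)
    qed (use fT T.parts_disjoint ne True ct n_large finW cW T.parts_cover in auto)
  next
    case False
    show ?thesis
    proof (rule sparse_or_dense_pair[where I = "part2 T" and J = "part1 T" and W = W and n = n and t = t
          and R = "adjacent G" and Q = "adjacent T"])
      show "\<nexists>f. (\<forall>x\<in>part2 T \<union> part1 T. f x \<in> W x) \<and>
          (\<forall>i\<in>part2 T. \<forall>j\<in>part1 T. adjacent G (f i) (f j) \<longleftrightarrow> adjacent T i j)"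
      proof
        assume "\<exists>f. (\<forall>x\<in>part2 T \<union> part1 T. f x \<in> W x) \<and>
          (\<forall>i\<in>part2 T. \<forall>j\<in>part1 T. adjacent G (f i) (f j) \<longleftrightarrow> adjacent T i j)"
        then obtain f where f: "\<forall>x\<in>part2 T \<union> part1 T. f x \<in> W x"
          "\<forall>i\<in>part2 T. \<forall>j\<in>part1 T. adjacent G (f i) (f j) \<longleftrightarrow> adjacent T i j" by blast
        have "(adjacent G (f x) (f y) = True) \<longleftrightarrow> adjacent T x y"
          if "x \<in> part1 T" "y \<in> part2 T" for x y
          using f(2) that adjacent_commute[of T x y] adjacent_commute[of G "f x" "f y"] by simp
        moreover have "\<forall>x\<in>?V. f x \<in> W x" using f(1) T.parts_cover by auto
        ultimately show False using no_copy[OF sepW, of f True] by blast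
      qed
      fix i j X Y N pos
      assume "i \<in> part2 T" "j \<in> part1 T" "X \<subseteq> W i" "Y \<subseteq> W j"
        and "N \<le> real (card X)" "N \<le> real (card Y)"
        "\<And>a. a \<in> X \<Longrightarrow> real (card {b \<in> Y. adjacent G a b = pos}) \<le> N / (64 * real t ^ 4)"
        "\<And>b. b \<in> Y \<Longrightarrow> real (card {a \<in> X. adjacent G a b = pos}) \<le> N / (64 * real t ^ 4)"
        "64 * real t ^ 2 * (real n * (16 * real t ^ 2) powr (- real t)) \<le> N" "N \<le> real n"
      then show ?thesis using that[of Y N X pos] W1[of j] W2[of i] adjacent_commute[of G]
        by (auto simp: F_def U_def)
    qed (use fT T.parts_disjoint ne False ct n_large finW cW T.parts_cover in auto)
  qed
  define E where "E a b \<longleftrightarrow> (a \<in> part1 G \<and> b \<in> part2 G \<or> a \<in> part2 G \<and> b \<in> part1 G) \<and>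
      (adjacent G a b = pos)" for a b
  define \<Delta> where "\<Delta> = N / (64 * U ^ 4)"
  have N5: "64 * U\<^sup>2 * p * U powr (5 * L) \<le> N" using N(1) Fn by (simp add: U_def mult_ac)
  have \<Delta>1: "1 \<le> \<Delta>"
  proof -
    have "64 * U ^ 4 \<le> 64 * U\<^sup>2 * (p * U powr (5 * L))"
    proof -
      have "1 * U ^ 4 \<le> p * U powr (5 * L)" using p1 U5 U4 U0 by (intro mult_mono) auto
      moreover have "1 \<le> U\<^sup>2" using U2 by (intro one_le_power) auto
      moreover have "0 \<le> 1 * U ^ 4" using U0 by simp
      ultimately have "1 * (1 * U ^ 4) \<le> U\<^sup>2 * (p * U powr (5 * L))"
        using mult_mono[of 1 "U\<^sup>2" "1 * U ^ 4" "p * U powr (5 * L)"] by simp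
      then show ?thesis by simp
    qed
    then have "64 * U ^ 4 \<le> N" using N5 by (simp add: mult.assoc)
    moreover have "0 < 64 * U ^ 4" using U0 by linarith
    ultimately show ?thesis unfolding \<Delta>_def by (simp only: le_divide_eq_1_pos)
  qed
  have "\<exists>W f. separated T G W \<and> (\<forall>x\<in>?V. f x \<in> W x \<and> W x \<subseteq> (if x \<in> part1 T then part1 G else part2 G)) \<and>
    (\<forall>x\<in>?V. \<forall>y\<in>?V. E (f x) (f y) \<longleftrightarrow> ?TE x y)"
  proof (rule leveled_tree.copy_in_sparse[OF lt, where r = r and K = K and p = p and c = c
        and N = N and \<Delta> = \<Delta> and A = A and B = B])
    show "2 \<le> card ?V" using t by simp
    show "1 \<le> r" "r \<le> card ?V" by (rule r)+
    show "5 \<le> K" by (rule K5)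
    show "0 \<le> p" using p1 by simp
    show "lev x \<le> r" if "x \<in> ?V" for x by (rule lev[OF that])
    show "c \<in> ?V" "leveled_tree.desc ?V ?TE lev c = ?V" by (rule c)+
    show "(x \<in> part1 T) \<noteq> (y \<in> part1 T)" if "x \<in> ?V" "y \<in> ?V" "?TE x y" for x y
      using not_adjacent_same_part[OF T.bigraph_axioms, of x y] that T.parts_cover by blast
    show "E a b \<Longrightarrow> E b a" for a b using adjacent_commute[of G] by (auto simp: E_def)
    show "finite (part1 G)" "finite (part2 G)" by (rule fG)+
    show "part1 G \<inter> part2 G = {}" by (rule G.parts_disjoint)
    show "a \<in> part1 G \<and> b \<in> part2 G \<or> a \<in> part2 G \<and> b \<in> part1 G" if "E a b" for a b
      using that by (simp add: E_def)
    show "\<exists>a\<in>A. \<exists>b\<in>B. E a b" if AB: "A \<subseteq> part1 G" "B \<subseteq> part2 G" "p \<le> real (card A)" "p \<le> real (card B)" for A B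
    proof (rule ccontr)
      assume "\<not> ?thesis"
      then have "\<forall>a\<in>A. \<forall>b\<in>B. adjacent G a b \<noteq> pos" using AB by (auto simp: E_def)
      then have "pure_pair G A B"
        using AB G.parts_cover G.parts_disjoint unfolding pure_pair_def by (cases pos) auto
      then show False using none AB by blast
    qed
    show "\<exists>W. separated T G W \<and> (\<forall>x\<in>?V. W x \<subseteq> (if x \<in> part1 T then A else B) \<and> M / real (card ?V) \<le> real (card (W x)))"
      if "A \<subseteq> part1 G" "B \<subseteq> part2 G" "M \<le> real (card A)" "M \<le> real (card B)" "real (card ?V) ^ 2 \<le> M" for A B M
      by (rule separated_blocks[OF T G ne that])
    show "A \<subseteq> part1 G" "B \<subseteq> part2 G" "N \<le> real (card A)" "N \<le> real (card B)" by (rule A B)+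
    show "real (card {b \<in> B. E a b}) \<le> \<Delta>" if "a \<in> A" for a
    proof -
      have "{b \<in> B. E a b} = {b \<in> B. adjacent G a b = pos}" using A B that by (auto simp: E_def)
      then show ?thesis using degA[OF that] by (simp add: \<Delta>_def U_def)
    qed
    show "real (card {a \<in> A. E b a}) \<le> \<Delta>" if "b \<in> B" for b
    proof -
      have "{a \<in> A. E b a} = {a \<in> A. adjacent G a b = pos}"
        using A B that adjacent_commute[of G] by (auto simp: E_def)
      then show ?thesis using degB[OF that] by (simp add: \<Delta>_def U_def)
    qed
    show "1 \<le> \<Delta>" by (rule \<Delta>1)
    show "64 * real (card ?V) ^ 4 * \<Delta> \<le> N" using U0 t by (simp add: \<Delta>_def U_def)
    show "64 * real (card ?V) ^ 2 * p * real (card ?V) powr (3 * K ^ (r - 1)) * \<Delta> powr (2 / K) \<le> N"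
    proof -
      have N0: "0 \<le> N" using N5 p1 by (meson mult_nonneg_nonneg order_trans powr_ge_zero zero_le_power2 zero_le_numeral less_imp_le zero_le_one)
      have "\<Delta> \<le> N / 1" unfolding \<Delta>_def using U0 N0 by (intro divide_left_mono) auto
      then have "\<Delta> \<le> real n" using N(2) by simp
      then have "\<Delta> powr (2 / K) \<le> real n powr (2 / K)" using \<Delta>1 K5 by (intro powr_mono2) auto
      also have "\<dots> = U powr (2 * L)" using K5 by (simp add: nU' powr_powr mult.commute)
      finally have "64 * U\<^sup>2 * p * U powr (3 * L) * \<Delta> powr (2 / K) \<le> 64 * U\<^sup>2 * p * U powr (3 * L) * U powr (2 * L)"
        using p1 by (intro mult_left_mono) auto
      also have "\<dots> = 64 * U\<^sup>2 * p * U powr (5 * L)"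
        by (simp add: mult.assoc flip: powr_add)
      also have "\<dots> \<le> N" by (rule N5)
      finally show ?thesis using t by (simp add: U_def L_def)
    qed
  qed
  then obtain W' f where sep': "separated T G W'" and f: "\<And>x. x \<in> ?V \<Longrightarrow> f x \<in> W' x"
    and W': "\<And>x. x \<in> ?V \<Longrightarrow> W' x \<subseteq> (if x \<in> part1 T then part1 G else part2 G)"
    and E: "\<And>x y. \<lbrakk>x \<in> ?V; y \<in> ?V\<rbrakk> \<Longrightarrow> E (f x) (f y) \<longleftrightarrow> ?TE x y" by blast
  have "(adjacent G (f x) (f y) = pos) \<longleftrightarrow> adjacent T x y" if xy: "x \<in> part1 T" "y \<in> part2 T" for x y
  proof -
    have V: "x \<in> ?V" "y \<in> ?V" using xy T.parts_cover by auto
    have "y \<notin> part1 T" using xy T.parts_disjoint by blast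
    then have "f x \<in> part1 G" "f y \<in> part2 G"
      using f[OF V(1)] f[OF V(2)] W'[OF V(1)] W'[OF V(2)] xy(1) by auto
    then show ?thesis using E[OF V] V by (auto simp: E_def)
  qed
  then show False using no_copy[OF sep', of f pos] f by blast
qed

theorem mainTheorem4:
  fixes T :: "'a ordered_bigraph" and G :: "'b ordered_bigraph"
    and r t n :: nat and K :: real
  assumes "ordered_tree_bigraph T"
    and "radius T = r"
    and "card (verts T) = t" and "t \<ge> 2"
    and "n \<ge> 1"
    and "ordered_bigraph G"
    and "\<not> contains G T" and "\<not> contains G (bicomplement T)"
    and "card (part1 G) \<ge> n" and "card (part2 G) \<ge> n"
    and "K \<ge> 0" and "real t powr (K ^ r) = real n"
  shows "\<exists>Z1 Z2. pure_pair G Z1 Z2 \<and> Z1 \<subseteq> part1 G \<and> Z2 \<subseteq> part2 G \<and>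
    real (card Z1) \<ge> (16 * real t ^ 2) powr (- real t) * real n * real t powr (- 5 * K ^ (r - 1)) \<and>
    real (card Z2) \<ge> (16 * real t ^ 2) powr (- real t) * real n * real t powr (- 5 * K ^ (r - 1))"
proof (cases "1 < (16 * real t ^ 2) powr (- real t) * real n * real t powr (- 5 * K ^ (r - 1))")
  case True
  from large_pure_pair[OF assms(1-4,6-12) refl True] show ?thesis .
next
  case False
  interpret G: ordered_bigraph G by (rule assms(6))
  have "part1 G \<noteq> {}" "part2 G \<noteq> {}" using assms(5,9,10) by auto
  then obtain a b where ab: "a \<in> part1 G" "b \<in> part2 G" by blast
  then have "a \<noteq> b" using G.parts_disjoint by blast
  \<comment> \<open>a bound of at most 1 is met by two single vertices, which always form a pure pair\<close>
  then have "pure_pair G {a} {b}" using ab G.parts_cover by (auto simp: pure_pair_def)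
  then show ?thesis using ab False by (intro exI[of _ "{a}"] exI[of _ "{b}"]) auto
qed

end
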